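(* Let $n\ge 2$, let $G\subsetneq\mathbb{R}^n$ be a proper subdomain, and let $h:G\to\mathbb{R}^n$ be a harmonic mapping whose image $h(G)$ is a proper subdomain of $\mathbb{R}^n$. Then the following conditions are equivalent: (1) $h$ satisfies the weak uniform boundedness property on $G$, i.e. there is a constant $c>0$ such that for all $x,y\in G$, $r_G(x,y)\le 1/2$ implies $r_{h(G)}(h(x),h(y))\le c$; (2) $h:(G,k_G)\to(h(G),k_{h(G)})$ is Lipschitz, i.e. there is a constant $L>0$ such that $k_{h(G)}(h(x),h(y))\le L\,k_G(x,y)$ for all $x,y\in G$.
   Context: A mapping $h=(h_1,\dots,h_n):G\to\mathbb{R}^n$ on a domain $G\subset\mathbb{R}^n$ is harmonic if each $h_i$ is a harmonic function ($\Delta h_i=0$). A domain is a nonempty open connected set. For a proper subdomain $D\subsetneq\mathbb{R}^n$ and $x,y\in D$: $d(x)=d(x,\partial D)$ is the Euclidean distance from $x$ to $\partial D$; $r_D(x,y)=\dfrac{|x-y|}{\min\{d(x),d(y)\}}$; and the quasihyperbolic metric is $k_D(x,y)=\inf_\gamma\int_\gamma \frac{ds}{d(z,\partial D)}$, the infimum over all rectifiable curves $\gamma$ in $D$ joining $x$ and $y$. *)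

theory Defs
  imports "HOL-Analysis.Analysis"
begin

definition is_domain :: "(real ^ 'n) set \<Rightarrow> bool" where
  "is_domain D \<longleftrightarrow> open D \<and> connected D \<and> D \<noteq> {}"

definition proper_subdomain :: "(real ^ 'n) set \<Rightarrow> bool" where
  "proper_subdomain D \<longleftrightarrow> is_domain D \<and> D \<noteq> UNIV"

text \<open>The value is meaningful only where \<open>u\<close> is differentiable.\<close>

definition partial_deriv :: "'n \<Rightarrow> (real ^ 'n \<Rightarrow> real) \<Rightarrow> real ^ 'n \<Rightarrow> real" where
  "partial_deriv i u x = frechet_derivative u (at x) (axis i 1)"

text \<open>For open \<open>S\<close> this is the usual class of functions having continuous partial derivatives
  up to order two: continuous partial derivatives imply differentiability.\<close>

definition C2_on :: "(real ^ 'n) set \<Rightarrow> (real ^ 'n \<Rightarrow> real) \<Rightarrow> bool" where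
  "C2_on S u \<longleftrightarrow>
     u differentiable_on S \<and>
     (\<forall>i. partial_deriv i u differentiable_on S) \<and>
     (\<forall>i j. continuous_on S (partial_deriv j (partial_deriv i u)))"

definition laplacian :: "(real ^ 'n \<Rightarrow> real) \<Rightarrow> real ^ 'n \<Rightarrow> real" where
  "laplacian u x = (\<Sum>i\<in>UNIV. partial_deriv i (partial_deriv i u) x)"

definition harmonic_on :: "(real ^ 'n) set \<Rightarrow> (real ^ 'n \<Rightarrow> real) \<Rightarrow> bool" where
  "harmonic_on S u \<longleftrightarrow> C2_on S u \<and> (\<forall>x\<in>S. laplacian u x = 0)"

definition harmonic_mapping_on :: "(real ^ 'n) set \<Rightarrow> (real ^ 'n \<Rightarrow> real ^ 'n) \<Rightarrow> bool" where
  "harmonic_mapping_on S h \<longleftrightarrow> (\<forall>i. harmonic_on S (\<lambda>x. h x $ i))"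

definition bdist :: "(real ^ 'n) set \<Rightarrow> real ^ 'n \<Rightarrow> real" where
  "bdist D x = infdist x (frontier D)"

definition r_dist :: "(real ^ 'n) set \<Rightarrow> real ^ 'n \<Rightarrow> real ^ 'n \<Rightarrow> real" where
  "r_dist D x y = norm (x - y) / min (bdist D x) (bdist D y)"

text \<open>Length of \<open>\<gamma>\<close> restricted to \<open>{a..b}\<close> (for \<open>a \<le> b\<close>): the supremum of the lengths of
  inscribed polygons over all partitions \<open>a = t 0 \<le> \<dots> \<le> t n = b\<close>.\<close>

definition curve_length :: "(real \<Rightarrow> real ^ 'n) \<Rightarrow> real \<Rightarrow> real \<Rightarrow> ennreal" where
  "curve_length \<gamma> a b =
     (SUP (n, t) \<in> {(n::nat, t::nat \<Rightarrow> real). mono_on {..n} t \<and> t 0 = a \<and> t n = b}.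
        \<Sum>k<n. ennreal (dist (\<gamma> (t k)) (\<gamma> (t (Suc k)))))"

definition rectifiable_path :: "(real \<Rightarrow> real ^ 'n) \<Rightarrow> bool" where
  "rectifiable_path \<gamma> \<longleftrightarrow> path \<gamma> \<and> curve_length \<gamma> 0 1 < \<infinity>"

text \<open>The arc length function \<open>s(t)\<close>, the length of \<open>\<gamma>\<close> on \<open>{0..t}\<close>, extended to all of the real
  line by constants outside \<open>{0..1}\<close>.\<close>

definition arc_length_fun :: "(real \<Rightarrow> real ^ 'n) \<Rightarrow> real \<Rightarrow> real" where
  "arc_length_fun \<gamma> t = enn2real (curve_length \<gamma> 0 (max 0 (min 1 t)))"

text \<open>The integral of \<open>\<rho>\<close> along \<open>\<gamma>\<close> with respect to arc length, as the Lebesgue--Stieltjes integral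
  of \<open>\<rho> \<circ> \<gamma>\<close> against \<open>ds\<close>.  For a rectifiable path \<open>s\<close> is nondecreasing and continuous, so that
  the interval measure of \<open>s\<close> is the Stieltjes measure \<open>ds\<close>.\<close>

definition arc_length_integral :: "(real \<Rightarrow> real ^ 'n) \<Rightarrow> (real ^ 'n \<Rightarrow> real) \<Rightarrow> real" where
  "arc_length_integral \<gamma> \<rho> =
     set_lebesgue_integral (interval_measure (arc_length_fun \<gamma>)) {0..1} (\<lambda>t. \<rho> (\<gamma> t))"

definition quasihyp_dist :: "(real ^ 'n) set \<Rightarrow> real ^ 'n \<Rightarrow> real ^ 'n \<Rightarrow> real" where
  "quasihyp_dist D x y =
     (INF \<gamma> \<in> {\<gamma>. rectifiable_path \<gamma> \<and> path_image \<gamma> \<subseteq> D \<and> pathstart \<gamma> = x \<and> pathfinish \<gamma> = y}.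
        arc_length_integral \<gamma> (\<lambda>z. 1 / bdist D z))"

definition weak_uniform_boundedness ::
    "(real ^ 'n) set \<Rightarrow> (real ^ 'n \<Rightarrow> real ^ 'n) \<Rightarrow> bool" where
  "weak_uniform_boundedness G h \<longleftrightarrow>
     (\<exists>c>0. \<forall>x\<in>G. \<forall>y\<in>G. r_dist G x y \<le> 1/2 \<longrightarrow> r_dist (h ` G) (h x) (h y) \<le> c)"

definition quasihyp_lipschitz ::
    "(real ^ 'n) set \<Rightarrow> (real ^ 'n \<Rightarrow> real ^ 'n) \<Rightarrow> bool" where
  "quasihyp_lipschitz G h \<longleftrightarrow>
     (\<exists>L>0. \<forall>x\<in>G. \<forall>y\<in>G. quasihyp_dist (h ` G) (h x) (h y) \<le> L * quasihyp_dist G x y)"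

end

theory Submission
  imports Defs
begin

text \<open>From weak uniform boundedness to Lipschitz: reflecting a harmonic function in a hyperplane and
  comparing the odd part with a quadratic barrier on a half cube bounds each partial derivative by
  the oscillation over the side length.  Weak uniform boundedness controls the oscillation of \<open>h\<close> on
  \<open>B(p, d(p)/3)\<close> by \<open>d(h(p))\<close>, so that \<open>h\<close> is locally Lipschitz with constant comparable to
  \<open>d(h(p)) / d(p)\<close>, and the quasihyperbolic length of \<open>h \<circ> \<gamma>\<close> is at most a constant times that
  of \<open>\<gamma>\<close>.  For the converse, \<open>k\<close> is at most \<open>1\<close> for points with \<open>r \<le> 1/2\<close>,
  while \<open>ln (1 + |a - b| / d(a)) \<le> 2 k(a, b)\<close> in every proper subdomain.\<close>

section \<open>The gradient estimate for harmonic functions\<close>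

text \<open>The gradient estimate rests on the maximum principle alone; no integral representation
  of harmonic functions enters. The odd part vanishes on the hyperplane of reflection, so a barrier
  that grows linearly along the normal at the centre suffices, and linear growth is exactly what
  bounds a difference quotient. The scaling then fits: with oscillation a multiple of d(h(p)), the
  factor d(h(p)) in the local Lipschitz constant cancels against the density 1 / d(h(z)) of the
  target, which weak uniform boundedness keeps comparable to 1 / d(h(p)) for z near p. The other
  obstacle is that line integrals are Stieltjes integrals along curves that are only rectifiable, so
  there is no speed to which a chain rule could apply. Lengths of \<open>h\<close> composed with a
  curve are therefore compared through inscribed polygons on short subarcs, which additivity joins
  together.\<close>

lemma second_derivative_at_local_max:
  fixes g :: "real \<Rightarrow> real"
  assumes "0 < \<delta>"
    and g: "\<And>s. \<bar>s\<bar> < \<delta> \<Longrightarrow> (g has_real_derivative g' s) (at s)"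
    and g': "(g' has_real_derivative D) (at 0)"
    and max: "\<And>s. \<bar>s\<bar> < \<delta> \<Longrightarrow> g s \<le> g 0"
  shows "D \<le> 0"
proof (rule ccontr)
  assume "\<not> D \<le> 0"
  then obtain e where e: "e > 0" "\<And>s. 0 < s \<Longrightarrow> s < e \<Longrightarrow> g' 0 < g' s"
    using DERIV_pos_inc_right[OF g'] by auto
  have "g' 0 = 0"
    by (rule DERIV_local_max[OF g[of 0] \<open>0 < \<delta>\<close>]) (use max \<open>0 < \<delta>\<close> in auto)
  \<comment> \<open>A positive \<open>D\<close> makes \<open>g'\<close> positive just to the right
    of its zero at \<open>0\<close>, so the mean value theorem on \<open>{0..s}\<close> gives
    \<open>g s > g 0\<close>.\<close>
  define s where "s = min \<delta> e / 2"
  have s: "0 < s" "s < \<delta>" "s < e"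
    using e \<open>0 < \<delta>\<close> by (auto simp: s_def min_def)
  obtain r where r: "0 < r" "r < s" "g s - g 0 = (s - 0) * g' r"
    using MVT2[of 0 s g g'] g s by auto
  then have "0 < (s - 0) * g' r"
    using e(2)[of r] s \<open>g' 0 = 0\<close> by simp
  then show False
    using r max[of s] s by auto
qed

text \<open>The factor \<open>c\<close> serves the reflected line, which is traversed backwards with
  \<open>c = -1\<close>. Taking \<open>f\<close> to be a partial derivative gives second
  derivatives.\<close>

lemma has_derivative_along_axis:
  fixes f :: "real ^ 'n \<Rightarrow> real"
  assumes "f differentiable at (x + (c * s) *\<^sub>R axis j 1)"
  shows "((\<lambda>r. f (x + (c * r) *\<^sub>R axis j 1)) has_real_derivative
           c * partial_deriv j f (x + (c * s) *\<^sub>R axis j 1)) (at s)"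
proof -
  let ?y = "x + (c * s) *\<^sub>R axis j (1::real)"
  let ?D = "frechet_derivative f (at ?y)"
  have D: "(f has_derivative ?D) (at ?y)"
    using assms frechet_derivative_works by blast
  have "((\<lambda>r. x + (c * r) *\<^sub>R axis j (1::real)) has_derivative (\<lambda>r. (c * r) *\<^sub>R axis j 1)) (at s)"
    by (auto intro!: derivative_eq_intros)
  from has_derivative_compose[OF this D]
  have "((\<lambda>r. f (x + (c * r) *\<^sub>R axis j 1)) has_derivative (\<lambda>r. ?D ((c * r) *\<^sub>R axis j 1))) (at s)" .
  moreover have "(\<lambda>r. ?D ((c * r) *\<^sub>R axis j 1)) = (\<lambda>r. c * partial_deriv j f ?y * r)"
    using linear_scale[OF has_derivative_linear[OF D]]
    by (auto simp: partial_deriv_def fun_eq_iff)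
  ultimately show ?thesis
    by (simp add: has_field_derivative_def)
qed

lemma sum_square_shift_axis:
  fixes w z :: "real ^ 'n"
  shows "(\<Sum>k\<in>UNIV. ((w + s *\<^sub>R axis j 1) $ k - z $ k)\<^sup>2)
       = (\<Sum>k\<in>UNIV. (w $ k - z $ k)\<^sup>2) + 2 * s * (w $ j - z $ j) + s\<^sup>2"
proof -
  have "((w + s *\<^sub>R axis j 1) $ k - z $ k)\<^sup>2
      = (w $ k - z $ k)\<^sup>2 + (if k = j then 2 * s * (w $ j - z $ j) + s\<^sup>2 else 0)" for k
    by (auto simp: axis_def power2_eq_square algebra_simps)
  then show ?thesis
    by (simp add: sum.distrib)
qed

text \<open>The barrier \<open>\<psi>\<close> has Laplacian \<open>- 2 * M / e\<^sup>2\<close>, is nonnegative on the half cube \<open>H\<close> and at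
  least \<open>M\<close> on those faces of \<open>H\<close> that belong to the cube, while the odd part of \<open>u\<close> vanishes on
  the remaining face.  Hence \<open>f\<close>, the odd part minus \<open>\<psi>\<close>, has positive Laplacian and no positive maximum.\<close>

lemma harmonic_reflection_bound:
  fixes u :: "real ^ 'n \<Rightarrow> real" and z :: "real ^ 'n" and e M :: real
  assumes "open S" and harm: "harmonic_on S u"
    and e: "0 < e" and cube: "{w. \<forall>j. \<bar>w $ j - z $ j\<bar> \<le> e} \<subseteq> S"
    and M: "0 < M" and bound: "\<And>w. \<forall>j. \<bar>w $ j - z $ j\<bar> \<le> e \<Longrightarrow> \<bar>u w - \<kappa>\<bar> \<le> M"
    and \<tau>: "\<bar>\<tau>\<bar> = 1" and t: "0 \<le> t" "t \<le> e"
  shows "\<tau> * (u (z + t *\<^sub>R axis i 1) - u (z - t *\<^sub>R axis i 1)) / 2 \<le> (real CARD('n) + 1) * M * t / e"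
proof -
  define n where "n = real CARD('n)"
  define R where "R w = w - (2 * (w $ i - z $ i)) *\<^sub>R axis i 1" for w :: "real ^ 'n"
  define q where "q w = (\<Sum>k\<in>UNIV. (w $ k - z $ k)\<^sup>2)" for w :: "real ^ 'n"
  define p where "p y = e * y - y\<^sup>2" for y
  \<comment> \<open>\<open>q\<close> has Laplacian \<open>2 * n\<close> and the term with
    \<open>p\<close> has Laplacian \<open>-2\<close>; the weight \<open>n + 1\<close> is chosen to
    make the total \<open>-2\<close>. Since \<open>p\<close> is nonnegative between \<open>0\<close>
    and \<open>e\<close>, it does not spoil the lower bound by \<open>q\<close> on the
    faces.\<close>
  define \<psi> where "\<psi> w = M / e\<^sup>2 * (q w + (n + 1) * p (w $ i - z $ i))" for w
  define f where "f w = \<tau> * (u w - u (R w)) / 2 - \<psi> w" for w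
  define Q where "Q = {w. \<forall>j. \<bar>w $ j - z $ j\<bar> \<le> e}"
  define H where "H = Q \<inter> {w. z $ i \<le> w $ i}"
  have n: "n \<ge> 0" by (simp add: n_def)
  have C2: "C2_on S u" and lap: "\<And>x. x \<in> S \<Longrightarrow> laplacian u x = 0"
    using harm by (auto simp: harmonic_on_def)
  have du: "u differentiable at x" "partial_deriv j u differentiable at x" if "x \<in> S" for x j
    using C2 that \<open>open S\<close> at_within_open unfolding C2_on_def differentiable_on_def by metis+
  have QS: "Q \<subseteq> S" using cube by (simp add: Q_def)
  have Rcomp: "R w $ j - z $ j = (if j = i then -1 else 1) * (w $ j - z $ j)" for w j
    by (auto simp: R_def axis_def)
  have RQ: "R w \<in> Q" if "w \<in> Q" for w
    using that unfolding Q_def by (auto simp: Rcomp abs_mult)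
  have Qbox: "Q = cbox (z - e *\<^sub>R (\<chi> j. 1)) (z + e *\<^sub>R (\<chi> j. 1))"
    unfolding Q_def by (auto simp: mem_box_cart abs_le_iff algebra_simps)
  have "compact H"
    unfolding H_def Qbox
    by (intro compact_Int_closed compact_cbox closed_Collect_le continuous_intros)
  have contu: "continuous_on Q u"
    using QS C2 unfolding C2_on_def
    by (meson continuous_on_subset differentiable_imp_continuous_on)
  have contR: "continuous_on Q R"
    unfolding R_def by (intro continuous_intros)
  have "continuous_on Q (\<lambda>w. u (R w))"
    by (rule continuous_on_compose2[OF contu contR]) (use RQ in auto)
  then have "continuous_on Q f"
    unfolding f_def \<psi>_def q_def p_def by (intro continuous_intros contu) auto
  then have contf: "continuous_on H f"
    by (rule continuous_on_subset) (simp add: H_def)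
  have "z + t *\<^sub>R axis i 1 \<in> H"
    using t e by (auto simp: H_def Q_def axis_def)
  then obtain w where w: "w \<in> H" and wmax: "\<And>v. v \<in> H \<Longrightarrow> f v \<le> f w"
    using continuous_attains_sup[OF \<open>compact H\<close> _ contf] by blast
  have y: "0 \<le> w $ i - z $ i" "w $ i - z $ i \<le> e"
    using w by (auto simp: H_def Q_def abs_le_iff)
  have wQ: "w \<in> Q" using w by (simp add: H_def)
  have "f w \<le> 0"
  proof -
    have pnn: "0 \<le> p (w $ i - z $ i)"
      using mult_left_mono[OF y(2) y(1)] unfolding p_def by (simp add: power2_eq_square mult.commute)
    consider "w $ i = z $ i" | j where "\<bar>w $ j - z $ j\<bar> = e"
      | "w $ i > z $ i" "\<forall>j. \<bar>w $ j - z $ j\<bar> < e"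
    proof -
      have "\<forall>j. \<bar>w $ j - z $ j\<bar> = e \<or> \<bar>w $ j - z $ j\<bar> < e" "w $ i = z $ i \<or> w $ i > z $ i"
        using wQ y(1) by (auto simp: Q_def le_less)
      then show ?thesis using that by metis
    qed
    then show ?thesis
    proof cases
      case 1
      then have "R w = w" by (simp add: R_def)
      moreover have "0 \<le> q w" by (simp add: q_def sum_nonneg)
      ultimately show ?thesis
        using M n 1 by (simp add: f_def \<psi>_def p_def)
    next
      case (2 j)
      have "\<bar>u w - \<kappa>\<bar> \<le> M" "\<bar>u (R w) - \<kappa>\<bar> \<le> M"
        using bound wQ RQ[OF wQ] by (auto simp: Q_def)
      then have "\<bar>u w - u (R w)\<bar> \<le> 2 * M" by linarith
      then have 1: "\<tau> * (u w - u (R w)) / 2 \<le> M"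
        using \<tau> abs_le_D1[of "\<tau> * (u w - u (R w))" "2 * M"] by (simp add: abs_mult)
      have "e\<^sup>2 = (w $ j - z $ j)\<^sup>2" using 2 by (metis power2_abs)
      also have "\<dots> \<le> q w"
        unfolding q_def by (rule member_le_sum) auto
      finally have "e\<^sup>2 \<le> q w + (n + 1) * p (w $ i - z $ i)"
        using n pnn by (smt (verit) mult_nonneg_nonneg)
      then have "M / e\<^sup>2 * e\<^sup>2 \<le> \<psi> w"
        unfolding \<psi>_def using M by (intro mult_left_mono) auto
      then show ?thesis using 1 e by (simp add: f_def)
    next
      case 3
      have "q w \<ge> 0" by (simp add: q_def sum_nonneg)
      define \<sigma> where "\<sigma> j = (if j = i then -1 else 1::real)" for j
      \<comment> \<open>The reflection reverses lines in direction \<open>i\<close> and preserves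
        the other axis directions. In a second derivative the sign \<open>\<sigma> j\<close> enters
        squared, which is why \<open>u\<close> composed with \<open>R\<close> has the Laplacian of
        \<open>u\<close> at the reflected point.\<close>
      have Rshift: "R (w + s *\<^sub>R axis j 1) = R w + (\<sigma> j * s) *\<^sub>R axis j 1" for s j
        by (auto simp: R_def \<sigma>_def axis_def vec_eq_iff algebra_simps)
      define b where "b j = (if j = i then 1 else 0 :: real)" for j
      have second: "\<tau> * (partial_deriv j (partial_deriv j u) w
            - partial_deriv j (partial_deriv j u) (R w)) / 2
          - M / e\<^sup>2 * (2 - b j * (2 * (n + 1))) \<le> 0" for j
      proof -
        define \<delta> where "\<delta> = min (e - \<bar>w $ j - z $ j\<bar>) (w $ i - z $ i)"
        have \<delta>: "\<delta> > 0" using 3 by (auto simp: \<delta>_def)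
        have inH: "w + s *\<^sub>R axis j 1 \<in> H" if "\<bar>s\<bar> < \<delta>" for s
        proof -
          have "\<bar>w $ j - z $ j + s\<bar> \<le> e" "z $ i \<le> w $ i + s"
            using that by (auto simp: \<delta>_def)
          then show ?thesis
            using wQ y(1) by (auto simp: H_def Q_def axis_def algebra_simps)
        qed
        define g where "g s = f (w + s *\<^sub>R axis j 1)" for s
        \<comment> \<open>The factors \<open>1 *\<close> and \<open>\<sigma> j *\<close> give both
          terms the shape required by \<open>has_derivative_along_axis\<close>.\<close>
        have geq: "g = (\<lambda>s. \<tau> * (u (w + (1 * s) *\<^sub>R axis j 1) - u (R w + (\<sigma> j * s) *\<^sub>R axis j 1)) / 2
            - M / e\<^sup>2 * (q w + 2 * s * (w $ j - z $ j) + s\<^sup>2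
                + (n + 1) * p (w $ i - z $ i + b j * s)))"
          unfolding g_def f_def \<psi>_def Rshift q_def sum_square_shift_axis
          by (auto simp: b_def axis_def algebra_simps fun_eq_iff)
        define g' where "g' s = \<tau> * (1 * partial_deriv j u (w + (1 * s) *\<^sub>R axis j 1)
              - \<sigma> j * partial_deriv j u (R w + (\<sigma> j * s) *\<^sub>R axis j 1)) / 2
            - M / e\<^sup>2 * (2 * (w $ j - z $ j) + 2 * s
                + (n + 1) * (b j * e - 2 * b j * (w $ i - z $ i + b j * s)))" for s
        have inS: "w + (1 * s) *\<^sub>R axis j 1 \<in> S" "R w + (\<sigma> j * s) *\<^sub>R axis j 1 \<in> S"
          if "\<bar>s\<bar> < \<delta>" for s
          using inH[OF that] RQ[of "w + s *\<^sub>R axis j 1"] QS by (auto simp: H_def Rshift)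
        have 1: "(g has_real_derivative g' s) (at s)" if "\<bar>s\<bar> < \<delta>" for s
          unfolding geq g'_def
        proof (rule DERIV_diff)
          show "((\<lambda>s. \<tau> * (u (w + (1 * s) *\<^sub>R axis j 1) - u (R w + (\<sigma> j * s) *\<^sub>R axis j 1)) / 2)
              has_real_derivative \<tau> * (1 * partial_deriv j u (w + (1 * s) *\<^sub>R axis j 1)
              - \<sigma> j * partial_deriv j u (R w + (\<sigma> j * s) *\<^sub>R axis j 1)) / 2) (at s)"
            by (intro DERIV_cdivide DERIV_cmult DERIV_diff has_derivative_along_axis du inS that)
          show "((\<lambda>s. M / e\<^sup>2 * (q w + 2 * s * (w $ j - z $ j) + s\<^sup>2
                + (n + 1) * p (w $ i - z $ i + b j * s))) has_real_derivative
              M / e\<^sup>2 * (2 * (w $ j - z $ j) + 2 * s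
                + (n + 1) * (b j * e - 2 * b j * (w $ i - z $ i + b j * s)))) (at s)"
            unfolding p_def
            by (intro DERIV_cmult) (auto intro!: derivative_eq_intros simp: algebra_simps)
        qed
        have 2: "(g' has_real_derivative \<tau> * (1 * (1 * partial_deriv j (partial_deriv j u) (w + (1 * 0) *\<^sub>R axis j 1))
              - \<sigma> j * (\<sigma> j * partial_deriv j (partial_deriv j u) (R w + (\<sigma> j * 0) *\<^sub>R axis j 1))) / 2
            - M / e\<^sup>2 * (2 + (n + 1) * (- 2 * b j * b j))) (at 0)"
          unfolding g'_def
        proof (rule DERIV_diff)
          show "((\<lambda>s. \<tau> * (1 * partial_deriv j u (w + (1 * s) *\<^sub>R axis j 1)
              - \<sigma> j * partial_deriv j u (R w + (\<sigma> j * s) *\<^sub>R axis j 1)) / 2) has_real_derivative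
            \<tau> * (1 * (1 * partial_deriv j (partial_deriv j u) (w + (1 * 0) *\<^sub>R axis j 1))
              - \<sigma> j * (\<sigma> j * partial_deriv j (partial_deriv j u) (R w + (\<sigma> j * 0) *\<^sub>R axis j 1))) / 2) (at 0)"
            using \<delta> by (intro DERIV_cdivide DERIV_cmult DERIV_diff has_derivative_along_axis du inS) auto
          show "((\<lambda>s. M / e\<^sup>2 * (2 * (w $ j - z $ j) + 2 * s
                + (n + 1) * (b j * e - 2 * b j * (w $ i - z $ i + b j * s)))) has_real_derivative
              M / e\<^sup>2 * (2 + (n + 1) * (- 2 * b j * b j))) (at 0)"
            by (intro DERIV_cmult) (auto intro!: derivative_eq_intros simp: algebra_simps)
        qed
        have "\<tau> * (1 * (1 * partial_deriv j (partial_deriv j u) (w + (1 * 0) *\<^sub>R axis j 1))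
              - \<sigma> j * (\<sigma> j * partial_deriv j (partial_deriv j u) (R w + (\<sigma> j * 0) *\<^sub>R axis j 1))) / 2
            - M / e\<^sup>2 * (2 + (n + 1) * (- 2 * b j * b j)) \<le> 0"
          by (rule second_derivative_at_local_max[OF \<delta> 1 2])
            (use wmax inH in \<open>auto simp: g_def\<close>)
        then show ?thesis
          by (simp add: \<sigma>_def b_def algebra_simps split: if_splits)
      qed
      have "(\<Sum>j\<in>UNIV. \<tau> * (partial_deriv j (partial_deriv j u) w
            - partial_deriv j (partial_deriv j u) (R w)) / 2
          - M / e\<^sup>2 * (2 - b j * (2 * (n + 1)))) \<le> 0"
        by (rule sum_nonpos) (rule second)
      moreover have "(\<Sum>j\<in>UNIV. \<tau> * (partial_deriv j (partial_deriv j u) w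
            - partial_deriv j (partial_deriv j u) (R w)) / 2
          - M / e\<^sup>2 * (2 - b j * (2 * (n + 1))))
        = \<tau> * (laplacian u w - laplacian u (R w)) / 2 - M / e\<^sup>2 * (2 * n - 2 * (n + 1))"
        unfolding laplacian_def n_def b_def
        by (simp add: sum_subtractf flip: sum_distrib_left sum_divide_distrib sum_distrib_right)
      moreover have "laplacian u w = 0" "laplacian u (R w) = 0"
        using lap QS wQ RQ by blast+
      \<comment> \<open>The left-hand side is the Laplacian of \<open>f\<close> at \<open>w\<close>,
        namely \<open>2 * M / e\<^sup>2\<close>. It is positive, so an interior maximum is
        impossible and this case is contradictory.\<close>
      ultimately have "0 - M / e\<^sup>2 * (2 * n - 2 * (n + 1)) \<le> 0" by simp
      then have "M / e\<^sup>2 \<le> 0" by (simp add: algebra_simps divide_le_0_iff)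
      then show ?thesis using M e by (simp add: divide_le_0_iff)
    qed
  qed
  then have "f (z + t *\<^sub>R axis i 1) \<le> 0"
    using wmax[OF \<open>z + t *\<^sub>R axis i 1 \<in> H\<close>] by linarith
  moreover have "R (z + t *\<^sub>R axis i 1) = z - t *\<^sub>R axis i 1"
    by (auto simp: R_def axis_def vec_eq_iff)
  moreover have "q (z + t *\<^sub>R axis i 1) = t\<^sup>2"
    unfolding q_def sum_square_shift_axis by simp
  ultimately have "\<tau> * (u (z + t *\<^sub>R axis i 1) - u (z - t *\<^sub>R axis i 1)) / 2
      \<le> M / e\<^sup>2 * (t\<^sup>2 + (n + 1) * (e * t - t\<^sup>2))"
    by (simp add: f_def \<psi>_def p_def)
  also have "\<dots> \<le> M / e\<^sup>2 * ((n + 1) * (e * t))"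
    using n M by (intro mult_left_mono) (auto simp: algebra_simps)
  also have "\<dots> = (n + 1) * M * t / e"
    using e by (simp add: power2_eq_square field_simps)
  finally show ?thesis by (simp add: n_def add.commute)
qed

text \<open>Dividing the reflection bound by \<open>t\<close> bounds the symmetric difference
  quotient, which tends to the partial derivative; the two signs \<open>\<tau>\<close> yield the
  absolute value. The reference value \<open>\<kappa>\<close> makes this a bound by oscillation
  instead of by size.\<close>

lemma harmonic_gradient_bound:
  fixes u :: "real ^ 'n \<Rightarrow> real" and z :: "real ^ 'n" and e M :: real
  assumes "open S" and harm: "harmonic_on S u"
    and e: "0 < e" and cube: "{w. \<forall>j. \<bar>w $ j - z $ j\<bar> \<le> e} \<subseteq> S"
    and M: "0 < M" and bound: "\<And>w. \<forall>j. \<bar>w $ j - z $ j\<bar> \<le> e \<Longrightarrow> \<bar>u w - \<kappa>\<bar> \<le> M"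
  shows "\<bar>partial_deriv i u z\<bar> \<le> (real CARD('n) + 1) * M / e"
proof -
  have "z \<in> S" using cube e by force
  then have du: "u differentiable at z"
    using harm \<open>open S\<close> at_within_open unfolding harmonic_on_def C2_on_def differentiable_on_def by metis
  then have "((\<lambda>t. (u (z + (1 * t) *\<^sub>R axis i 1) - u (z + ((-1) * t) *\<^sub>R axis i 1)) / 2) has_real_derivative
      (1 * partial_deriv i u (z + (1 * 0) *\<^sub>R axis i 1)
        - (-1) * partial_deriv i u (z + ((-1) * 0) *\<^sub>R axis i 1)) / 2) (at 0)"
    by (intro DERIV_cdivide DERIV_diff has_derivative_along_axis) auto
  then have D: "((\<lambda>t. (u (z + t *\<^sub>R axis i 1) - u (z - t *\<^sub>R axis i 1)) / 2) has_real_derivative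
      partial_deriv i u z) (at 0)"
    by simp
  have lim: "((\<lambda>t. (u (z + t *\<^sub>R axis i 1) - u (z - t *\<^sub>R axis i 1)) / 2 / t)
      \<longlongrightarrow> partial_deriv i u z) (at_right 0)"
    using D by (auto simp: DERIV_def intro: filterlim_mono at_le)
  have ev: "\<forall>\<^sub>F t in at_right 0. t > 0 \<and> t < e"
    using e eventually_at_right_less[of 0] eventually_at_right_real[of 0 e] by (auto simp: eventually_conj)
  have "\<tau> * partial_deriv i u z \<le> (real CARD('n) + 1) * M / e" if \<tau>: "\<bar>\<tau>\<bar> = 1" for \<tau>
  proof (rule tendsto_upperbound[OF tendsto_mult_left[OF lim]])
    show "\<forall>\<^sub>F t in at_right 0. \<tau> * ((u (z + t *\<^sub>R axis i 1) - u (z - t *\<^sub>R axis i 1)) / 2 / t)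
       \<le> (real CARD('n) + 1) * M / e"
      using ev
    proof eventually_elim
      case (elim t)
      then show ?case
        using harmonic_reflection_bound[OF assms \<tau>, of t i] by (simp add: divide_simps mult_ac)
    qed
  qed simp
  from this[of 1] this[of "-1"] show ?thesis by (simp add: abs_le_iff)
qed

text \<open>The three factors \<open>CARD('n)\<close> come from the half side \<open>d / n\<close>
  of the cubes, from estimating a differential by its partial derivatives, and from summing over the
  components of \<open>h\<close>.\<close>

lemma harmonic_mapping_lipschitz:
  fixes h :: "real ^ 'n \<Rightarrow> real ^ 'n" and p x y :: "real ^ 'n" and d M :: real
  assumes "open S" and harm: "harmonic_mapping_on S h"
    and d: "0 < d" and ball: "cball p (2 * d) \<subseteq> S"
    and M: "0 < M" and bound: "\<And>w. w \<in> cball p (2 * d) \<Longrightarrow> norm (h w - h p) \<le> M"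
    and xy: "x \<in> cball p d" "y \<in> cball p d"
  shows "norm (h x - h y) \<le> real CARD('n) ^ 3 * (real CARD('n) + 1) * M / d * norm (x - y)"
proof -
  define n where "n = real CARD('n)"
  have n: "n \<ge> 1" by (simp add: n_def Suc_leI)
  \<comment> \<open>By the l1 bound for the norm, a cube of half side \<open>d / n\<close> fits into
    a ball of radius \<open>d\<close>, so cubes about points of \<open>cball p d\<close> stay in
    \<open>cball p (2 * d)\<close>.\<close>
  define e where "e = d / n"
  have e: "e > 0" using d n by (simp add: e_def)
  define B where "B = (n + 1) * M / e"
  have B: "B \<ge> 0" using e M n by (simp add: B_def)
  have near: "w \<in> cball p (2 * d)" if z: "z \<in> cball p d" and w: "\<forall>j. \<bar>w $ j - z $ j\<bar> \<le> e" for w z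
  proof -
    have "norm (w - z) \<le> (\<Sum>j\<in>UNIV. \<bar>(w - z) $ j\<bar>)" by (rule norm_le_l1_cart)
    also have "\<dots> \<le> (\<Sum>j\<in>(UNIV::'n set). e)" using w by (intro sum_mono) auto
    also have "\<dots> = d" using n by (simp add: e_def n_def)
    finally show ?thesis
      using z norm_triangle_ineq[of "p - z" "z - w"] by (simp add: dist_norm norm_minus_commute)
  qed
  have comp: "\<bar>h x $ k - h y $ k\<bar> \<le> n * B * norm (x - y)" for k
  proof -
    define u where "u = (\<lambda>w. h w $ k)"
    have u: "harmonic_on S u" using harm by (simp add: harmonic_mapping_on_def u_def)
    have pd: "\<bar>partial_deriv i u z\<bar> \<le> B" if z: "z \<in> cball p d" for z i
      unfolding B_def n_def
    proof (rule harmonic_gradient_bound[OF \<open>open S\<close> u e _ M])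
      show "{w. \<forall>j. \<bar>w $ j - z $ j\<bar> \<le> e} \<subseteq> S" using near[OF z] ball by blast
      fix w assume "\<forall>j. \<bar>w $ j - z $ j\<bar> \<le> e"
      from bound[OF near[OF z this]] show "\<bar>u w - u p\<bar> \<le> M"
        using component_le_norm_cart[of "h w - h p" k] by (simp add: u_def)
    qed
    have D: "(u has_derivative frechet_derivative u (at z)) (at z within cball p d)"
      if z: "z \<in> cball p d" for z
    proof -
      have "z \<in> S" using z ball d by force
      then have "u differentiable at z"
        using u \<open>open S\<close> at_within_open
        unfolding harmonic_on_def C2_on_def differentiable_on_def by metis
      then show ?thesis
        using frechet_derivative_works has_derivative_at_withinI by blast
    qed
    have on: "onorm (frechet_derivative u (at z)) \<le> n * B" if z: "z \<in> cball p d" for z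
    proof (rule onorm_le)
      fix v :: "real ^ 'n"
      have lin: "linear (frechet_derivative u (at z))"
        using D[OF z] has_derivative_linear by blast
      have v: "v = (\<Sum>i\<in>UNIV. v $ i *\<^sub>R axis i 1)"
        using basis_expansion[of v] by (simp add: scalar_mult_eq_scaleR)
      have "frechet_derivative u (at z) v = frechet_derivative u (at z) (\<Sum>i\<in>UNIV. v $ i *\<^sub>R axis i 1)"
        using v by simp
      also have "\<dots> = (\<Sum>i\<in>UNIV. v $ i * partial_deriv i u z)"
        by (simp add: linear_sum[OF lin] linear_scale[OF lin] partial_deriv_def)
      finally have "norm (frechet_derivative u (at z) v) \<le> (\<Sum>i\<in>UNIV. \<bar>v $ i * partial_deriv i u z\<bar>)"
        by simp
      also have "\<dots> \<le> (\<Sum>i\<in>(UNIV::'n set). norm v * B)"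
        by (intro sum_mono) (auto simp: abs_mult intro!: mult_mono component_le_norm_cart pd z)
      finally show "norm (frechet_derivative u (at z) v) \<le> n * B * norm v"
        by (simp add: n_def mult_ac)
    qed
    show ?thesis
      using differentiable_bound[OF convex_cball D on xy] by (simp add: u_def)
  qed
  have "norm (h x - h y) \<le> (\<Sum>k\<in>UNIV. \<bar>(h x - h y) $ k\<bar>)" by (rule norm_le_l1_cart)
  also have "\<dots> \<le> (\<Sum>k\<in>(UNIV::'n set). n * B * norm (x - y))"
    using comp by (intro sum_mono) auto
  also have "\<dots> = n ^ 3 * (n + 1) * M / d * norm (x - y)"
    using d n by (simp add: B_def e_def n_def power3_eq_cube)
  finally show ?thesis by (simp add: n_def add.commute)
qed

section \<open>Arc length and its Stieltjes integral\<close>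

definition polygon_length :: "(real \<Rightarrow> real ^ 'n) \<Rightarrow> nat \<Rightarrow> (nat \<Rightarrow> real) \<Rightarrow> real" where
  "polygon_length \<gamma> n t = (\<Sum>k<n. dist (\<gamma> (t k)) (\<gamma> (t (Suc k))))"

definition partition_of :: "real \<Rightarrow> real \<Rightarrow> nat \<Rightarrow> (nat \<Rightarrow> real) \<Rightarrow> bool" where
  "partition_of a b n t \<longleftrightarrow> mono_on {..n} t \<and> t 0 = a \<and> t n = b"

lemma polygon_length_nonneg: "0 \<le> polygon_length \<gamma> n t"
  by (simp add: polygon_length_def sum_nonneg)

lemma curve_length_altdef:
  "curve_length \<gamma> a b = (SUP (n, t) \<in> {(n, t). partition_of a b n t}. ennreal (polygon_length \<gamma> n t))"
  unfolding curve_length_def partition_of_def polygon_length_def by (simp add: sum_ennreal)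

lemma polygon_le_curve_length:
  "partition_of a b n t \<Longrightarrow> ennreal (polygon_length \<gamma> n t) \<le> curve_length \<gamma> a b"
  unfolding curve_length_altdef by (rule SUP_upper2[of "(n, t)"]) auto

lemma curve_length_least:
  "(\<And>n t. partition_of a b n t \<Longrightarrow> ennreal (polygon_length \<gamma> n t) \<le> X) \<Longrightarrow> curve_length \<gamma> a b \<le> X"
  unfolding curve_length_altdef by (rule SUP_least) auto

lemma partition_of_mem:
  assumes "partition_of a b n t" "k \<le> n"
  shows "a \<le> t k" "t k \<le> b"
  using assms mono_onD[of "{..n}" t 0 k] mono_onD[of "{..n}" t k n] by (auto simp: partition_of_def)

lemma partition_of_Suc_le:
  assumes "partition_of a b n t" "k < n"
  shows "t k \<le> t (Suc k)"
  using assms mono_onD[of "{..n}" t k "Suc k"] by (auto simp: partition_of_def)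

lemma partition_of_two: "a \<le> b \<Longrightarrow> partition_of a b 1 (\<lambda>k. if k = 0 then a else b)"
  by (auto simp: partition_of_def intro!: mono_onI)

lemma dist_le_curve_length:
  assumes "a \<le> b"
  shows "ennreal (dist (\<gamma> a) (\<gamma> b)) \<le> curve_length \<gamma> a b"
  using polygon_le_curve_length[OF partition_of_two[OF assms], of \<gamma>] by (simp add: polygon_length_def)

text \<open>Cutting a partition at an intermediate point \<open>b\<close> by truncation keeps the index set,
  so that the two truncated polygons can be compared with the original one edge by edge.\<close>

lemma partition_of_min:
  assumes "partition_of a c n t" "a \<le> b" "b \<le> c"
  shows "partition_of a b n (\<lambda>k. min (t k) b)"
proof -
  have "mono_on {..n} t" "t 0 = a" "t n = c" using assms(1) by (auto simp: partition_of_def)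
  then show ?thesis
    using assms(2,3) unfolding partition_of_def
    by (intro conjI mono_onI min.mono order_refl) (auto intro!: mono_onD[of "{..n}" t])
qed

lemma partition_of_max:
  assumes "partition_of a c n t" "a \<le> b" "b \<le> c"
  shows "partition_of b c n (\<lambda>k. max (t k) b)"
proof -
  have "mono_on {..n} t" "t 0 = a" "t n = c" using assms(1) by (auto simp: partition_of_def)
  then show ?thesis
    using assms(2,3) unfolding partition_of_def
    by (intro conjI mono_onI max.mono order_refl) (auto intro!: mono_onD[of "{..n}" t])
qed

text \<open>An edge on one side of \<open>b\<close> survives in one truncation and degenerates to a
  point in the other. An edge across \<open>b\<close> becomes two edges meeting at
  \<open>\<gamma> b\<close>, and the triangle inequality applies.\<close>

lemma polygon_length_split:
  assumes "partition_of a c n t"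
  shows "polygon_length \<gamma> n t
    \<le> polygon_length \<gamma> n (\<lambda>k. min (t k) b) + polygon_length \<gamma> n (\<lambda>k. max (t k) b)"
proof -
  have "dist (\<gamma> (t k)) (\<gamma> (t (Suc k)))
      \<le> dist (\<gamma> (min (t k) b)) (\<gamma> (min (t (Suc k)) b)) + dist (\<gamma> (max (t k) b)) (\<gamma> (max (t (Suc k)) b))"
    if "k < n" for k
    using partition_of_Suc_le[OF assms that] dist_triangle[of "\<gamma> (t k)" "\<gamma> (t (Suc k))" "\<gamma> b"]
    by (auto simp: min_def max_def)
  then show ?thesis
    unfolding polygon_length_def sum.distrib[symmetric] by (intro sum_mono) auto
qed

lemma partition_of_append:
  assumes t: "partition_of a b n t" and s: "partition_of b c m s"
  defines "r \<equiv> \<lambda>k. if k \<le> n then t k else s (k - n)"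
  shows "partition_of a c (n + m) r"
    and "polygon_length \<gamma> (n + m) r = polygon_length \<gamma> n t + polygon_length \<gamma> m s"
proof -
  \<comment> \<open>The case \<open>k = 0\<close> uses \<open>t n = b = s 0\<close>: index
    \<open>n\<close> belongs to both partitions.\<close>
  have r': "r (n + k) = s k" for k
    using t s by (auto simp: r_def partition_of_def)
  have "r i \<le> r j" if "i \<le> j" "j \<le> n + m" for i j
  proof -
    consider "j \<le> n" | "i \<le> n" "n < j" | "n < i" by linarith
    then show ?thesis
    proof cases
      case 1 then show ?thesis
        using that t by (auto simp: r_def partition_of_def intro: mono_onD)
    next
      case 2
      then have "r i \<le> b" "b \<le> r j"
        using partition_of_mem(2)[OF t, of i] partition_of_mem(1)[OF s, of "j - n"] that by (auto simp: r_def)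
      then show ?thesis by simp
    next
      case 3 then show ?thesis
        using that s by (auto simp: r_def partition_of_def intro!: mono_onD[of "{..m}" s])
    qed
  qed
  then show "partition_of a c (n + m) r"
    using t s r'[of m] unfolding partition_of_def by (auto intro!: mono_onI simp: r_def)
  have "polygon_length \<gamma> (n + m) r
      = (\<Sum>k<n. dist (\<gamma> (r k)) (\<gamma> (r (Suc k)))) + (\<Sum>k<m. dist (\<gamma> (r (n + k))) (\<gamma> (r (n + Suc k))))"
    unfolding polygon_length_def by (induction m) (auto simp: add.assoc)
  also have "(\<Sum>k<n. dist (\<gamma> (r k)) (\<gamma> (r (Suc k)))) = polygon_length \<gamma> n t"
    unfolding polygon_length_def by (rule sum.cong) (auto simp: r_def)
  finally show "polygon_length \<gamma> (n + m) r = polygon_length \<gamma> n t + polygon_length \<gamma> m s"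
    by (simp only: r' polygon_length_def)
qed

lemma curve_length_add:
  assumes "a \<le> b" "b \<le> c"
  shows "curve_length \<gamma> a c = curve_length \<gamma> a b + curve_length \<gamma> b c"
proof (rule antisym)
  show "curve_length \<gamma> a c \<le> curve_length \<gamma> a b + curve_length \<gamma> b c"
  proof (rule curve_length_least)
    fix n t assume t: "partition_of a c n t"
    have "ennreal (polygon_length \<gamma> n t)
        \<le> ennreal (polygon_length \<gamma> n (\<lambda>k. min (t k) b)) + ennreal (polygon_length \<gamma> n (\<lambda>k. max (t k) b))"
      by (simp add: polygon_length_split[OF t] polygon_length_nonneg flip: ennreal_plus)
    also have "\<dots> \<le> curve_length \<gamma> a b + curve_length \<gamma> b c"
      by (intro add_mono polygon_le_curve_length partition_of_min[OF t] partition_of_max[OF t] assms)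
    finally show "ennreal (polygon_length \<gamma> n t) \<le> curve_length \<gamma> a b + curve_length \<gamma> b c" .
  qed
  \<comment> \<open>In \<open>ennreal\<close> a supremum commutes with adding a constant only over a
    nonempty index set, since the empty supremum is \<open>0\<close>.\<close>
  have ne: "{(n, t). partition_of a b n t} \<noteq> {}" if "a \<le> b" for a b :: real
    using partition_of_two[OF that] by blast
  show "curve_length \<gamma> a b + curve_length \<gamma> b c \<le> curve_length \<gamma> a c"
    unfolding curve_length_altdef[of \<gamma> a b] ennreal_SUP_add_left[OF ne[OF assms(1)], symmetric]
  proof (rule SUP_least, clarsimp)
    fix n t assume t: "partition_of a b n t"
    show "ennreal (polygon_length \<gamma> n t) + curve_length \<gamma> b c \<le> curve_length \<gamma> a c"
      unfolding curve_length_altdef[of \<gamma> b c] ennreal_SUP_add_right[OF ne[OF assms(2)]]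
    proof (rule SUP_least, clarsimp)
      fix m s assume s: "partition_of b c m s"
      show "ennreal (polygon_length \<gamma> n t) + ennreal (polygon_length \<gamma> m s) \<le> curve_length \<gamma> a c"
        using polygon_le_curve_length[OF partition_of_append(1)[OF t s], of \<gamma>]
        by (simp add: partition_of_append(2)[OF t s] polygon_length_nonneg)
    qed
  qed
qed

text \<open>The increments of \<open>\<Lambda>\<close> telescope over every partition. A linear
  \<open>\<Lambda>\<close> handles Lipschitz curves; a multiple of
  \<open>arc_length_fun \<gamma>\<close> handles the image of \<open>\<gamma>\<close> under a
  locally Lipschitz map.\<close>

lemma curve_length_le_increment:
  assumes "\<And>s t. a \<le> s \<Longrightarrow> s \<le> t \<Longrightarrow> t \<le> b \<Longrightarrow> dist (\<gamma> s) (\<gamma> t) \<le> \<Lambda> t - \<Lambda> s"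
  shows "curve_length \<gamma> a b \<le> ennreal (\<Lambda> b - \<Lambda> a)"
proof (rule curve_length_least)
  fix n t assume t: "partition_of a b n t"
  have "polygon_length \<gamma> n t \<le> (\<Sum>k<n. \<Lambda> (t (Suc k)) - \<Lambda> (t k))"
    unfolding polygon_length_def
    by (intro sum_mono assms partition_of_mem[OF t] partition_of_Suc_le[OF t]) auto
  also have "\<dots> = \<Lambda> b - \<Lambda> a"
    using t by (simp add: sum_lessThan_telescope[of "\<lambda>k. \<Lambda> (t k)"] partition_of_def)
  finally show "ennreal (polygon_length \<gamma> n t) \<le> ennreal (\<Lambda> b - \<Lambda> a)"
    by (rule ennreal_leI)
qed

lemma curve_length_subinterval:
  assumes "a \<le> s" "s \<le> t" "t \<le> b"
  shows "curve_length \<gamma> s t \<le> curve_length \<gamma> a b"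
proof -
  have "curve_length \<gamma> a b = curve_length \<gamma> a s + (curve_length \<gamma> s t + curve_length \<gamma> t b)"
    using assms curve_length_add[of a s b \<gamma>] curve_length_add[of s t b \<gamma>] by simp
  then show ?thesis
    by (metis add_increasing add_increasing2 order_refl zero_le)
qed

section \<open>The arc length function of a rectifiable curve and its right continuity\<close>

lemma rectifiable_curve_length_finite:
  assumes "rectifiable_path \<gamma>" "0 \<le> s" "s \<le> t" "t \<le> 1"
  shows "curve_length \<gamma> s t < top"
  using assms curve_length_subinterval[of 0 s t 1 \<gamma>] by (auto simp: rectifiable_path_def)

lemma arc_length_fun_diff:
  assumes "rectifiable_path \<gamma>" "0 \<le> s" "s \<le> t" "t \<le> 1"
  shows "ennreal (arc_length_fun \<gamma> t - arc_length_fun \<gamma> s) = curve_length \<gamma> s t"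
    and "arc_length_fun \<gamma> s \<le> arc_length_fun \<gamma> t"
proof -
  have fin: "curve_length \<gamma> 0 s < top" "curve_length \<gamma> s t < top"
    using assms by (auto intro!: rectifiable_curve_length_finite)
  have "arc_length_fun \<gamma> t = enn2real (curve_length \<gamma> 0 s + curve_length \<gamma> s t)"
    using assms curve_length_add[of 0 s t \<gamma>] by (simp add: arc_length_fun_def)
  also have "\<dots> = arc_length_fun \<gamma> s + enn2real (curve_length \<gamma> s t)"
    using fin assms by (simp add: enn2real_plus arc_length_fun_def)
  finally have eq: "arc_length_fun \<gamma> t = arc_length_fun \<gamma> s + enn2real (curve_length \<gamma> s t)" .
  then show "ennreal (arc_length_fun \<gamma> t - arc_length_fun \<gamma> s) = curve_length \<gamma> s t"
    using fin by simp
  show "arc_length_fun \<gamma> s \<le> arc_length_fun \<gamma> t"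
    using eq by simp
qed

lemma dist_le_arc_length_fun_diff:
  assumes "rectifiable_path \<gamma>" "0 \<le> s" "s \<le> t" "t \<le> 1"
  shows "dist (\<gamma> s) (\<gamma> t) \<le> arc_length_fun \<gamma> t - arc_length_fun \<gamma> s"
proof -
  have "ennreal (dist (\<gamma> s) (\<gamma> t)) \<le> ennreal (arc_length_fun \<gamma> t - arc_length_fun \<gamma> s)"
    unfolding arc_length_fun_diff(1)[OF assms] by (rule dist_le_curve_length[OF assms(3)])
  then show ?thesis
    using arc_length_fun_diff(2)[OF assms] by (simp add: ennreal_le_iff)
qed

lemma arc_length_fun_clamp: "arc_length_fun \<gamma> t = arc_length_fun \<gamma> (max 0 (min 1 t))"
  by (simp add: arc_length_fun_def)

lemma arc_length_fun_mono:
  assumes "rectifiable_path \<gamma>" "s \<le> t"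
  shows "arc_length_fun \<gamma> s \<le> arc_length_fun \<gamma> t"
  unfolding arc_length_fun_clamp[of \<gamma> s] arc_length_fun_clamp[of \<gamma> t]
  by (rule arc_length_fun_diff(2)) (use assms in auto)

lemma path_uniform:
  fixes \<gamma> :: "real \<Rightarrow> real ^ 'n"
  assumes "path \<gamma>" "0 < \<epsilon>"
  obtains \<delta> where "0 < \<delta>"
    "\<And>s t. s \<in> {0..1} \<Longrightarrow> t \<in> {0..1} \<Longrightarrow> \<bar>s - t\<bar> \<le> \<delta> \<Longrightarrow> dist (\<gamma> s) (\<gamma> t) < \<epsilon>"
proof -
  have "uniformly_continuous_on {0..1} \<gamma>"
    using assms by (intro compact_uniformly_continuous) (auto simp: path_def)
  then obtain d where d: "d > 0"
    "\<And>s t. s \<in> {0..1} \<Longrightarrow> t \<in> {0..1} \<Longrightarrow> dist t s < d \<Longrightarrow> dist (\<gamma> t) (\<gamma> s) < \<epsilon>"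
    using \<open>0 < \<epsilon>\<close> unfolding uniformly_continuous_on_def by metis
  show ?thesis
    by (rule that[of "d / 2"]) (use d in \<open>auto simp: dist_real_def\<close>)
qed

text \<open>A partition of \<open>{a..1}\<close> whose polygon nearly exhausts the length has a fixed number of edges;
  truncating it at \<open>s\<close> close to \<open>a\<close> leaves on \<open>{a..s}\<close> only that many edges, all of them short.\<close>

lemma arc_length_fun_right_continuous:
  fixes \<gamma> :: "real \<Rightarrow> real ^ 'n"
  assumes \<gamma>: "rectifiable_path \<gamma>"
  shows "continuous (at_right a) (arc_length_fun \<gamma>)"
  unfolding continuous_within tendsto_iff eventually_at_right_field
proof (intro allI impI)
  fix \<epsilon> :: real assume "\<epsilon> > 0"
  let ?F = "arc_length_fun \<gamma>"
  consider "a < 0" | "1 \<le> a" | "0 \<le> a" "a < 1" by linarith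
  then show "\<exists>b>a. \<forall>s>a. s < b \<longrightarrow> dist (?F s) (?F a) < \<epsilon>"
  proof cases
    case 1
    then have "dist (?F s) (?F a) < \<epsilon>" if "s < 0" for s
      using that \<open>\<epsilon> > 0\<close> by (simp add: arc_length_fun_def)
    then show ?thesis using 1 by blast
  next
    case 2
    then have "max 0 (min 1 s) = 1" if "s \<ge> a" for s
      using that by (simp add: min_def)
    then have "dist (?F s) (?F a) < \<epsilon>" if "s > a" for s
      using that \<open>\<epsilon> > 0\<close> by (simp add: arc_length_fun_def)
    then show ?thesis using gt_ex by blast
  next
    case 3
    \<comment> \<open>If every polygon fell short by \<open>\<epsilon> / 2\<close>, so would their
      supremum, which is the length on \<open>{a..1}\<close>.\<close>
    have "\<exists>n t. partition_of a 1 n t \<and> ?F 1 - ?F a < polygon_length \<gamma> n t + \<epsilon> / 2"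
    proof (rule ccontr)
      assume *: "\<not> ?thesis"
      have le: "polygon_length \<gamma> n t \<le> ?F 1 - ?F a - \<epsilon> / 2" if "partition_of a 1 n t" for n t
      proof -
        have "\<not> ?F 1 - ?F a < polygon_length \<gamma> n t + \<epsilon> / 2" using * that by blast
        then show ?thesis by linarith
      qed
      have "curve_length \<gamma> a 1 \<le> ennreal (?F 1 - ?F a - \<epsilon> / 2)"
        by (rule curve_length_least, rule ennreal_leI, rule le)
      then have "ennreal (?F 1 - ?F a) \<le> ennreal (?F 1 - ?F a - \<epsilon> / 2)"
        by (subst arc_length_fun_diff(1)[OF \<gamma>]) (use 3 in auto)
      \<comment> \<open>\<open>ennreal\<close> sends negative numbers to \<open>0\<close>;
        nonnegativity of the right-hand side allows the inequality to be read in the reals.\<close>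
      moreover have "\<epsilon> / 2 \<le> ?F 1 - ?F a"
        using le[OF partition_of_two[OF less_imp_le[OF 3(2)]]] polygon_length_nonneg[of \<gamma> 1 "\<lambda>k. if k = 0 then a else 1"]
        by linarith
      ultimately show False
        using \<open>\<epsilon> > 0\<close> by (simp add: ennreal_le_iff)
    qed
    then obtain n t where t: "partition_of a 1 n t" "?F 1 - ?F a < polygon_length \<gamma> n t + \<epsilon> / 2"
      by blast
    \<comment> \<open>The \<open>n\<close> truncated edges, each at most \<open>\<eta>\<close>, add
      up to at most \<open>\<epsilon> / 2\<close>; the \<open>+ 1\<close> keeps the denominator
      positive.\<close>
    define \<eta> where "\<eta> = \<epsilon> / (2 * (real n + 1))"
    have "\<eta> > 0" using \<open>\<epsilon> > 0\<close> by (simp add: \<eta>_def)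
    then obtain \<delta> where \<delta>: "0 < \<delta>"
      "\<And>s t. s \<in> {0..1} \<Longrightarrow> t \<in> {0..1} \<Longrightarrow> \<bar>s - t\<bar> \<le> \<delta> \<Longrightarrow> dist (\<gamma> s) (\<gamma> t) < \<eta>"
      using path_uniform[of \<gamma> \<eta>] \<gamma> unfolding rectifiable_path_def by blast
    have "dist (?F s) (?F a) < \<epsilon>" if s: "a < s" "s < min 1 (a + \<delta>)" for s
    proof -
      have s1: "s \<le> 1" using s by simp
      have "dist (\<gamma> (min (t k) s)) (\<gamma> (min (t (Suc k)) s)) \<le> \<eta>" if "k < n" for k
      proof -
        have "a \<le> t k" "a \<le> t (Suc k)"
          using partition_of_mem(1)[OF t(1)] that by auto
        then show ?thesis
          using s 3 by (intro less_imp_le[OF \<delta>(2)]) auto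
      qed
      then have "polygon_length \<gamma> n (\<lambda>k. min (t k) s) \<le> (\<Sum>k<n. \<eta>)"
        unfolding polygon_length_def by (intro sum_mono) auto
      also have "\<dots> \<le> \<epsilon> / 2"
        using \<open>\<epsilon> > 0\<close> by (simp add: \<eta>_def field_simps)
      finally have 1: "polygon_length \<gamma> n (\<lambda>k. min (t k) s) \<le> \<epsilon> / 2" .
      have "ennreal (polygon_length \<gamma> n (\<lambda>k. max (t k) s)) \<le> ennreal (?F 1 - ?F s)"
        unfolding arc_length_fun_diff(1)[OF \<gamma> order_trans[OF 3(1) less_imp_le[OF s(1)]] s1 order_refl]
        by (rule polygon_le_curve_length, rule partition_of_max[OF t(1) less_imp_le[OF s(1)] s1])
      then have "polygon_length \<gamma> n (\<lambda>k. max (t k) s) \<le> ?F 1 - ?F s"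
        using arc_length_fun_mono[OF \<gamma>, of s 1] s by (simp add: ennreal_le_iff)
      with 1 have "?F s - ?F a < \<epsilon>"
        using t(2) polygon_length_split[OF t(1), of \<gamma> s] by linarith
      then show ?thesis
        using arc_length_fun_mono[OF \<gamma>, of a s] s by (simp add: dist_real_def)
    qed
    then show ?thesis
      using 3 \<delta>(1) by (intro exI[of _ "min 1 (a + \<delta>)"]) auto
  qed
qed

section \<open>Stieltjes integrals against arc length\<close>

abbreviation arc_measure :: "(real \<Rightarrow> real ^ 'n) \<Rightarrow> real measure" where
  "arc_measure \<gamma> \<equiv> interval_measure (arc_length_fun \<gamma>)"

text \<open>Half-open intervals make consecutive pieces disjoint, and on them the interval measure
  is exactly the increment of arc length.\<close>

definition arc_integral_on ::
    "(real \<Rightarrow> real ^ 'n) \<Rightarrow> (real ^ 'n \<Rightarrow> real) \<Rightarrow> real \<Rightarrow> real \<Rightarrow> real" where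
  "arc_integral_on \<gamma> \<rho> s t = set_lebesgue_integral (arc_measure \<gamma>) {s<..t} (\<lambda>t. \<rho> (\<gamma> t))"

lemma emeasure_arc_measure:
  assumes "rectifiable_path \<gamma>" "s \<le> t"
  shows "emeasure (arc_measure \<gamma>) {s<..t} = ennreal (arc_length_fun \<gamma> t - arc_length_fun \<gamma> s)"
  using assms by (intro emeasure_interval_measure_Ioc arc_length_fun_mono arc_length_fun_right_continuous)

lemma set_integrable_arc_measure:
  assumes \<gamma>: "rectifiable_path \<gamma>" and f: "continuous_on {0..1} f" and st: "0 \<le> s" "t \<le> 1"
  shows "set_integrable (arc_measure \<gamma>) {s<..t} (f :: real \<Rightarrow> real)"
proof -
  have "compact (f ` {0..1})"
    by (intro compact_continuous_image f) auto
  then obtain B where B: "\<And>x. x \<in> {0..1} \<Longrightarrow> norm (f x) \<le> B"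
    by (metis compact_imp_bounded bounded_iff imageI)
  have "emeasure (arc_measure \<gamma>) {0..1} \<le> emeasure (arc_measure \<gamma>) {-1<..1}"
    by (intro emeasure_mono) auto
  also have "\<dots> < \<infinity>"
    using emeasure_arc_measure[OF \<gamma>, of "-1" 1] by simp
  finally have fin: "emeasure (arc_measure \<gamma>) {0..1} < \<infinity>" .
  have "set_integrable (arc_measure \<gamma>) {0..1} f"
    unfolding set_integrable_def
  proof (rule integrableI_bounded_set[where A = "{0..1}" and B = B])
    show "(\<lambda>x. indicat_real {0..1} x *\<^sub>R f x) \<in> borel_measurable (arc_measure \<gamma>)"
      using borel_measurable_continuous_on_indicator[OF _ f] by (simp cong: measurable_cong_sets)
  qed (use fin B in auto)
  then show ?thesis
    by (rule set_integrable_subset) (use st in auto)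
qed

lemma arc_integral_on_add:
  assumes "rectifiable_path \<gamma>" "continuous_on {0..1} (\<lambda>t. \<rho> (\<gamma> t))" "0 \<le> r" "r \<le> s" "s \<le> t" "t \<le> 1"
  shows "arc_integral_on \<gamma> \<rho> r t = arc_integral_on \<gamma> \<rho> r s + arc_integral_on \<gamma> \<rho> s t"
proof -
  have "{r<..t} = {r<..s} \<union> {s<..t}" using assms by auto
  then show ?thesis
    unfolding arc_integral_on_def using assms
    by (simp add: set_integral_Un set_integrable_arc_measure)
qed

text \<open>The arc length function is constant to the left of \<open>0\<close>, so
  \<open>{0}\<close> lies in a half-open interval of measure \<open>0\<close> and the left end point
  contributes nothing.\<close>

lemma arc_length_integral_eq:
  assumes \<gamma>: "rectifiable_path \<gamma>" and f: "continuous_on {0..1} (\<lambda>t. \<rho> (\<gamma> t))"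
  shows "arc_length_integral \<gamma> \<rho> = arc_integral_on \<gamma> \<rho> 0 1"
proof -
  have "emeasure (arc_measure \<gamma>) {0} \<le> emeasure (arc_measure \<gamma>) {-1<..0}"
    by (intro emeasure_mono) auto
  also have "\<dots> = 0"
    using emeasure_arc_measure[OF \<gamma>, of "-1" 0] arc_length_fun_clamp[of \<gamma> "-1"] by simp
  finally have "AE x in arc_measure \<gamma>. x \<notin> {0}"
    by (intro AE_not_in) (simp add: null_sets_def)
  have "(\<lambda>x. indicat_real {0<..1} x *\<^sub>R \<rho> (\<gamma> x)) \<in> borel_measurable (arc_measure \<gamma>)"
    using set_integrable_arc_measure[OF \<gamma> f, of 0 1] unfolding set_integrable_def
    by (intro borel_measurable_integrable) auto
  moreover have "(\<lambda>x. indicat_real {0..1} x *\<^sub>R \<rho> (\<gamma> x)) \<in> borel_measurable (arc_measure \<gamma>)"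
    using borel_measurable_continuous_on_indicator[OF _ f] by (simp cong: measurable_cong_sets)
  moreover have "AE x in arc_measure \<gamma>. indicat_real {0..1} x *\<^sub>R \<rho> (\<gamma> x) = indicat_real {0<..1} x *\<^sub>R \<rho> (\<gamma> x)"
    using \<open>AE x in arc_measure \<gamma>. x \<notin> {0}\<close>
  proof eventually_elim
    case (elim x)
    then have "x \<in> {0..1} \<longleftrightarrow> x \<in> {0<..1}" by auto
    then show ?case by (simp only: indicator_def)
  qed
  ultimately show ?thesis
    unfolding arc_length_integral_def arc_integral_on_def set_lebesgue_integral_def
    by (intro integral_cong_AE)
qed

lemma set_integral_const_arc_measure:
  assumes "rectifiable_path \<gamma>" "s \<le> t"
  shows "(LINT x:{s<..t}|arc_measure \<gamma>. B) = B * (arc_length_fun \<gamma> t - arc_length_fun \<gamma> s)"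
proof -
  have "measure (arc_measure \<gamma>) {s<..t} = arc_length_fun \<gamma> t - arc_length_fun \<gamma> s"
    using arc_length_fun_mono[OF assms] by (simp add: measure_def emeasure_arc_measure[OF assms])
  then show ?thesis
    by (simp add: set_lebesgue_integral_def mult.commute)
qed

lemma arc_integral_on_le:
  assumes "rectifiable_path \<gamma>" "continuous_on {0..1} (\<lambda>t. \<rho> (\<gamma> t))" "0 \<le> s" "s \<le> t" "t \<le> 1"
    and "\<And>r. s \<le> r \<Longrightarrow> r \<le> t \<Longrightarrow> \<rho> (\<gamma> r) \<le> B"
  shows "arc_integral_on \<gamma> \<rho> s t \<le> B * (arc_length_fun \<gamma> t - arc_length_fun \<gamma> s)"
  unfolding arc_integral_on_def set_integral_const_arc_measure[OF assms(1,4), symmetric]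
  using assms by (intro set_integral_mono set_integrable_arc_measure) auto

lemma arc_integral_on_ge:
  assumes "rectifiable_path \<gamma>" "continuous_on {0..1} (\<lambda>t. \<rho> (\<gamma> t))" "0 \<le> s" "s \<le> t" "t \<le> 1"
    and "\<And>r. s \<le> r \<Longrightarrow> r \<le> t \<Longrightarrow> B \<le> \<rho> (\<gamma> r)"
  shows "B * (arc_length_fun \<gamma> t - arc_length_fun \<gamma> s) \<le> arc_integral_on \<gamma> \<rho> s t"
  unfolding arc_integral_on_def set_integral_const_arc_measure[OF assms(1,4), symmetric]
  using assms by (intro set_integral_mono set_integrable_arc_measure) auto

text \<open>Cutting \<open>{0..1}\<close> into \<open>N\<close> equal pieces with
  \<open>1 / N < \<delta>\<close> passes from local to global. It serves the logarithmic lower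
  bound, the rectifiability of image curves and the comparison of their integrals.\<close>

lemma unit_interval_chain:
  fixes P :: "real \<Rightarrow> real \<Rightarrow> bool"
  assumes "0 < \<delta>"
    and loc: "\<And>s t. 0 \<le> s \<Longrightarrow> s \<le> t \<Longrightarrow> t \<le> 1 \<Longrightarrow> t - s \<le> \<delta> \<Longrightarrow> P s t"
    and trans: "\<And>r s t. 0 \<le> r \<Longrightarrow> r \<le> s \<Longrightarrow> s \<le> t \<Longrightarrow> t \<le> 1 \<Longrightarrow> P r s \<Longrightarrow> P s t \<Longrightarrow> P r t"
  shows "P 0 1"
proof -
  obtain N :: nat where N: "N > 0" "1 / real N < \<delta>"
    using nat_approx_posE[OF \<open>0 < \<delta>\<close>] by (metis zero_less_Suc)
  have "P 0 (real k / real N)" if "k \<le> N" for k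
    using that
  proof (induction k)
    case 0
    then show ?case using loc[of 0 0] \<open>0 < \<delta>\<close> by simp
  next
    case (Suc k)
    have le: "real k / real N \<le> real (Suc k) / real N" "real (Suc k) / real N \<le> 1"
      "real (Suc k) / real N - real k / real N \<le> \<delta>"
      using Suc.prems N by (auto simp: field_simps)
    show ?case
      by (rule trans[OF _ _ le(1,2) Suc.IH loc[OF _ le]]) (use Suc.prems in auto)
  qed
  from this[of N] show ?thesis using N by simp
qed

lemma lipschitz_rectifiable:
  fixes \<gamma> :: "real \<Rightarrow> real ^ 'n"
  assumes lip: "\<And>s t. 0 \<le> s \<Longrightarrow> s \<le> t \<Longrightarrow> t \<le> 1 \<Longrightarrow> dist (\<gamma> s) (\<gamma> t) \<le> K * (t - s)"
  shows "rectifiable_path \<gamma>" and "arc_length_fun \<gamma> 1 - arc_length_fun \<gamma> 0 \<le> K"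
proof -
  have K: "0 \<le> K" using order_trans[OF zero_le_dist lip[of 0 1]] by simp
  have cl: "curve_length \<gamma> 0 1 \<le> ennreal K"
    using curve_length_le_increment[of 0 1 \<gamma> "\<lambda>t. K * t"] lip by (simp add: algebra_simps)
  have "K-lipschitz_on {0..1} \<gamma>"
  proof (rule lipschitz_onI[OF _ K])
    fix s t :: real assume "s \<in> {0..1}" "t \<in> {0..1}"
    then show "dist (\<gamma> s) (\<gamma> t) \<le> K * dist s t"
      using lip[of s t] lip[of t s] by (cases "s \<le> t") (auto simp: dist_real_def dist_commute)
  qed
  then have "path \<gamma>"
    unfolding path_def by (rule lipschitz_on_continuous_on)
  then show rect: "rectifiable_path \<gamma>"
    using cl by (auto simp: rectifiable_path_def intro: le_less_trans)
  show "arc_length_fun \<gamma> 1 - arc_length_fun \<gamma> 0 \<le> K"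
  proof -
    have "ennreal (arc_length_fun \<gamma> 1 - arc_length_fun \<gamma> 0) \<le> ennreal K"
      using cl by (subst arc_length_fun_diff(1)[OF rect]) auto
    then show ?thesis using ennreal_le_iff[OF K] by blast
  qed
qed

section \<open>The quasihyperbolic metric\<close>

lemma frontier_proper_subdomain_ne:
  "proper_subdomain D \<Longrightarrow> frontier D \<noteq> {}"
  by (auto simp: proper_subdomain_def is_domain_def frontier_eq_empty)

lemma bdist_pos:
  assumes "proper_subdomain D" "x \<in> D"
  shows "0 < bdist D x"
proof -
  have "x \<notin> frontier D"
    using assms by (auto simp: proper_subdomain_def is_domain_def frontier_def interior_open)
  then show ?thesis
    unfolding bdist_def
    by (intro infdist_pos_not_in_closed frontier_closed frontier_proper_subdomain_ne assms)
qed

lemma bdist_le_add: "bdist D x \<le> bdist D y + dist x y"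
  unfolding bdist_def by (rule infdist_triangle)

text \<open>A ball about \<open>x\<close> that leaves \<open>D\<close> is connected and meets
  \<open>D\<close>, hence meets the frontier, at a point closer to \<open>x\<close> than the
  frontier is.\<close>

lemma ball_bdist_subset:
  assumes "proper_subdomain D" "x \<in> D"
  shows "ball x (bdist D x) \<subseteq> D"
proof (rule ccontr)
  assume "\<not> ?thesis"
  moreover have "x \<in> ball x (bdist D x) \<inter> D"
    using assms bdist_pos by simp
  ultimately have "ball x (bdist D x) \<inter> frontier D \<noteq> {}"
    by (intro connected_Int_frontier[OF connected_ball]) blast+
  then obtain f where "dist x f < bdist D x" "f \<in> frontier D" by auto
  then show False
    using infdist_le[of f "frontier D" x] by (simp add: bdist_def)
qed

lemma continuous_on_inverse_bdist:
  assumes "proper_subdomain D"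
  shows "continuous_on D (\<lambda>z. 1 / bdist D z)"
  using bdist_pos[OF assms] unfolding bdist_def
  by (intro continuous_intros) force

lemma continuous_on_path_inverse_bdist:
  assumes "proper_subdomain D" "path \<gamma>" "path_image \<gamma> \<subseteq> D"
  shows "continuous_on {0..1} (\<lambda>t. 1 / bdist D (\<gamma> t))"
  by (rule continuous_on_compose2[OF continuous_on_inverse_bdist])
    (use assms in \<open>auto simp: path_def path_image_def\<close>)

definition rectifiable_joins :: "(real ^ 'n) set \<Rightarrow> real ^ 'n \<Rightarrow> real ^ 'n \<Rightarrow> (real \<Rightarrow> real ^ 'n) \<Rightarrow> bool" where
  "rectifiable_joins D x y \<gamma> \<longleftrightarrow>
     rectifiable_path \<gamma> \<and> path_image \<gamma> \<subseteq> D \<and> pathstart \<gamma> = x \<and> pathfinish \<gamma> = y"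

lemma quasihyp_dist_altdef:
  "quasihyp_dist D x y = (INF \<gamma> \<in> {\<gamma>. rectifiable_joins D x y \<gamma>}. arc_length_integral \<gamma> (\<lambda>z. 1 / bdist D z))"
  by (simp add: quasihyp_dist_def rectifiable_joins_def)

lemma quasihyp_dist_le:
  assumes "rectifiable_joins D x y \<gamma>"
  shows "quasihyp_dist D x y \<le> arc_length_integral \<gamma> (\<lambda>z. 1 / bdist D z)"
  unfolding quasihyp_dist_altdef
proof (rule cINF_lower)
  have "0 \<le> arc_length_integral \<gamma> (\<lambda>z. 1 / bdist D z)" for \<gamma>
    unfolding arc_length_integral_def set_lebesgue_integral_def bdist_def
    by (rule integral_nonneg_AE) (simp add: infdist_nonneg)
  then show "bdd_below ((\<lambda>\<gamma>. arc_length_integral \<gamma> (\<lambda>z. 1 / bdist D z)) ` {\<gamma>. rectifiable_joins D x y \<gamma>})"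
    by (intro bdd_belowI[of _ 0]) auto
qed (use assms in simp)

text \<open>Lower bounds for the infimum of reals in \<open>quasihyp_dist\<close> need a nonempty
  set of curves. A polynomial path has bounded derivative on \<open>{0..1}\<close>, so it is
  Lipschitz and thus rectifiable.\<close>

lemma ex_rectifiable_joins:
  assumes "is_domain D" "x \<in> D" "y \<in> D"
  shows "\<exists>\<gamma>. rectifiable_joins D x y \<gamma>"
proof -
  obtain g where g: "polynomial_function g" "path_image g \<subseteq> D" "pathstart g = x" "pathfinish g = y"
    using connected_open_polynomial_connected[of D x y] assms by (auto simp: is_domain_def)
  obtain g' where g': "polynomial_function g'" "\<And>t. (g has_vector_derivative g' t) (at t)"
    using has_vector_derivative_polynomial_function[OF g(1)] by blast
  have "compact (g' ` {0..1})"
    by (intro compact_continuous_image continuous_on_polymonial_function g') auto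
  then obtain K where K: "\<And>t. t \<in> {0..1} \<Longrightarrow> norm (g' t) \<le> K"
    by (metis compact_imp_bounded bounded_iff imageI)
  have "dist (g s) (g t) \<le> K * (t - s)" if "0 \<le> s" "s \<le> t" "t \<le> 1" for s t
  proof -
    have "norm (g t - g s) \<le> K * norm (t - s)"
    proof (rule differentiable_bound[of "{0..1}"])
      show "(g has_derivative (\<lambda>h. h *\<^sub>R g' u)) (at u within {0..1})" for u
        using g'(2)[of u] unfolding has_vector_derivative_def by (rule has_derivative_at_withinI)
      show "onorm (\<lambda>h. h *\<^sub>R g' u) \<le> K" if "u \<in> {0..1}" for u
        using K[OF that] by (intro onorm_le) (simp add: mult.commute[of K] mult_left_mono)
    qed (use that in auto)
    then show ?thesis using that by (simp add: dist_norm norm_minus_commute)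
  qed
  then show ?thesis
    using lipschitz_rectifiable(1) g unfolding rectifiable_joins_def by blast
qed

lemma quasihyp_dist_greatest:
  assumes "is_domain D" "x \<in> D" "y \<in> D"
    and "\<And>\<gamma>. rectifiable_joins D x y \<gamma> \<Longrightarrow> c \<le> arc_length_integral \<gamma> (\<lambda>z. 1 / bdist D z)"
  shows "c \<le> quasihyp_dist D x y"
  unfolding quasihyp_dist_altdef
  by (rule cINF_greatest) (use ex_rectifiable_joins[OF assms(1-3)] assms(4) in auto)

text \<open>The segment is a competitor of length at most \<open>dist x y\<close>, along which the
  boundary distance is at least \<open>bdist D x - dist x y\<close>.\<close>

lemma quasihyp_dist_le_segment:
  assumes D: "proper_subdomain D" and x: "x \<in> D" and near: "dist x y < bdist D x"
  shows "quasihyp_dist D x y \<le> dist x y / (bdist D x - dist x y)"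
proof -
  let ?l = "linepath x y"
  have seg: "dist x z \<le> dist x y" if "z \<in> closed_segment x y" for z
    using that segment_bound(1)[of z x y] by (simp add: dist_norm norm_minus_commute)
  have lip: "dist (?l s) (?l t) \<le> dist x y * (t - s)" if "s \<le> t" for s t
  proof -
    have "?l s - ?l t = (t - s) *\<^sub>R (x - y)"
      by (simp add: linepath_def algebra_simps)
    then show ?thesis using that by (simp add: dist_norm)
  qed
  have rect: "rectifiable_path ?l" "arc_length_fun ?l 1 - arc_length_fun ?l 0 \<le> dist x y"
    using lipschitz_rectifiable[of ?l "dist x y"] lip by auto
  have im: "path_image ?l \<subseteq> D"
    using seg near ball_bdist_subset[OF D x] by fastforce
  have cont: "continuous_on {0..1} (\<lambda>t. 1 / bdist D (?l t))"
    by (rule continuous_on_path_inverse_bdist[OF D _ im]) simp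
  have "quasihyp_dist D x y \<le> arc_length_integral ?l (\<lambda>z. 1 / bdist D z)"
    using rect im by (intro quasihyp_dist_le) (simp add: rectifiable_joins_def)
  also have "\<dots> = arc_integral_on ?l (\<lambda>z. 1 / bdist D z) 0 1"
    by (rule arc_length_integral_eq[OF rect(1) cont])
  also have "\<dots> \<le> 1 / (bdist D x - dist x y) * (arc_length_fun ?l 1 - arc_length_fun ?l 0)"
  proof (rule arc_integral_on_le[OF rect(1) cont])
    fix r :: real assume "0 \<le> r" "r \<le> 1"
    then have "?l r \<in> closed_segment x y"
      using linepath_in_path by fastforce
    then have "bdist D x - dist x y \<le> bdist D (?l r)"
      using bdist_le_add[of D x "?l r"] seg by fastforce
    then show "1 / bdist D (?l r) \<le> 1 / (bdist D x - dist x y)"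
      using near by (intro divide_left_mono) auto
  qed auto
  also have "\<dots> \<le> 1 / (bdist D x - dist x y) * dist x y"
    using rect(2) near by (intro mult_left_mono) auto
  finally show ?thesis by simp
qed

text \<open>Along a short subarc the density \<open>1 / bdist D\<close> is at least \<open>1 / (2 * (d + q s))\<close>, where \<open>d\<close> is
  the boundary distance of the initial point \<open>x\<close> and \<open>q s\<close> the distance of \<open>\<gamma> s\<close> from \<open>x\<close>; summing
  \<open>ln v - ln u \<le> (v - u) / u\<close> over such subarcs yields the logarithm.\<close>

lemma arc_length_integral_ge_ln:
  assumes D: "proper_subdomain D" and x: "x \<in> D" and \<gamma>: "rectifiable_joins D x y \<gamma>"
  shows "ln (1 + dist x y / bdist D x) / 2 \<le> arc_length_integral \<gamma> (\<lambda>z. 1 / bdist D z)"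
proof -
  let ?\<rho> = "\<lambda>z. 1 / bdist D z"
  have rect: "rectifiable_path \<gamma>" and im: "path_image \<gamma> \<subseteq> D" and "\<gamma> 0 = x" "\<gamma> 1 = y" "path \<gamma>"
    using \<gamma> by (auto simp: rectifiable_joins_def rectifiable_path_def pathstart_def pathfinish_def)
  have cont: "continuous_on {0..1} (\<lambda>t. ?\<rho> (\<gamma> t))"
    by (rule continuous_on_path_inverse_bdist[OF D \<open>path \<gamma>\<close> im])
  define d where "d = bdist D x"
  define q where "q t = dist (\<gamma> t) x" for t
  have d: "d > 0" using bdist_pos[OF D x] by (simp add: d_def)
  have q: "q t \<ge> 0" for t by (simp add: q_def)
  have half: "u / 2 \<le> v" if "u \<le> 2 * v" for u v :: real using that by simp
  obtain \<delta> where \<delta>: "0 < \<delta>"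
    "\<And>s t. s \<in> {0..1} \<Longrightarrow> t \<in> {0..1} \<Longrightarrow> \<bar>s - t\<bar> \<le> \<delta> \<Longrightarrow> dist (\<gamma> s) (\<gamma> t) < d"
    using path_uniform[OF \<open>path \<gamma>\<close> d] by blast
  have "(ln (d + q 1) - ln (d + q 0)) / 2 \<le> arc_integral_on \<gamma> ?\<rho> 0 1"
  proof (rule unit_interval_chain[OF \<delta>(1),
        where P = "\<lambda>s t. (ln (d + q t) - ln (d + q s)) / 2 \<le> arc_integral_on \<gamma> ?\<rho> s t"])
    fix s t :: real assume st: "0 \<le> s" "s \<le> t" "t \<le> 1" "t - s \<le> \<delta>"
    have pos: "d + q s > 0" "d + q t > 0" using d q by (auto intro: add_pos_nonneg)
    have "ln (d + q t) - ln (d + q s) = ln ((d + q t) / (d + q s))"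
      using pos by (simp add: ln_div)
    also have "\<dots> \<le> (d + q t) / (d + q s) - 1"
      using pos by (intro ln_le_minus_one) auto
    also have "\<dots> = 2 * (1 / (2 * (d + q s)) * (q t - q s))"
      using pos by (simp add: field_simps)
    finally have "(ln (d + q t) - ln (d + q s)) / 2 \<le> 1 / (2 * (d + q s)) * (q t - q s)"
      by (rule half)
    also have "\<dots> \<le> 1 / (2 * (d + q s)) * (arc_length_fun \<gamma> t - arc_length_fun \<gamma> s)"
      using dist_le_arc_length_fun_diff[OF rect st(1-3)] dist_triangle[of "\<gamma> t" x "\<gamma> s"] pos
      by (intro mult_left_mono) (auto simp: q_def dist_commute)
    also have "\<dots> \<le> arc_integral_on \<gamma> ?\<rho> s t"
    proof (rule arc_integral_on_ge[OF rect cont st(1-3)])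
      fix r assume r: "s \<le> r" "r \<le> t"
      have "bdist D (\<gamma> r) \<le> d + dist (\<gamma> r) x"
        unfolding d_def by (rule bdist_le_add)
      \<comment> \<open>The step \<open>\<delta>\<close> lets \<open>\<gamma>\<close> move by less
        than \<open>d\<close> on a subarc. This extra \<open>d\<close> is the source of the factor
        \<open>2\<close> in the density bound and of the \<open>/ 2\<close> in the
        conclusion.\<close>
      also have "dist (\<gamma> r) x \<le> q s + d"
        using \<delta>(2)[of r s] r st dist_triangle[of "\<gamma> r" x "\<gamma> s"] by (simp add: q_def)
      finally have "bdist D (\<gamma> r) \<le> 2 * (d + q s)" using q[of s] by simp
      moreover have "\<gamma> r \<in> D" using im r st by (auto simp: path_image_def)
      ultimately show "1 / (2 * (d + q s)) \<le> ?\<rho> (\<gamma> r)"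
        using bdist_pos[OF D] pos by (intro divide_left_mono mult_pos_pos) auto
    qed
    finally show "(ln (d + q t) - ln (d + q s)) / 2 \<le> arc_integral_on \<gamma> ?\<rho> s t" .
  next
    fix r s t :: real assume "0 \<le> r" "r \<le> s" "s \<le> t" "t \<le> 1"
      "(ln (d + q s) - ln (d + q r)) / 2 \<le> arc_integral_on \<gamma> ?\<rho> r s"
      "(ln (d + q t) - ln (d + q s)) / 2 \<le> arc_integral_on \<gamma> ?\<rho> s t"
    then show "(ln (d + q t) - ln (d + q r)) / 2 \<le> arc_integral_on \<gamma> ?\<rho> r t"
      using arc_integral_on_add[OF rect cont, of r s t] by (simp add: diff_divide_distrib)
  qed
  moreover have "ln (d + q 1) - ln (d + q 0) = ln (1 + dist x y / d)"
  proof -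
    have "1 + dist x y / d = (d + dist x y) / d" using d by (simp add: field_simps)
    then show ?thesis
      using d add_pos_nonneg[OF d zero_le_dist[of x y]] \<open>\<gamma> 0 = x\<close> \<open>\<gamma> 1 = y\<close>
      by (simp add: q_def dist_commute ln_div)
  qed
  ultimately show ?thesis
    by (simp add: arc_length_integral_eq[OF rect cont] d_def)
qed

lemma quasihyp_dist_ge_ln:
  assumes D: "proper_subdomain D" and "x \<in> D" "y \<in> D"
  shows "ln (1 + dist x y / bdist D x) / 2 \<le> quasihyp_dist D x y"
  using assms arc_length_integral_ge_ln[OF D \<open>x \<in> D\<close>]
  by (intro quasihyp_dist_greatest) (auto simp: proper_subdomain_def)

text \<open>On a short subarc starting at \<open>p\<close>, the target density is at most
  \<open>A / bdist (h\<close> G) (h p)\<open>and lengths grow by at most\<close>C * bdist (h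
  \<open>G) (h p) / bdist G p\<close>. In the product the boundary distance of \<open>h p\<close>
  cancels and \<open>A * C / bdist G p\<close> remains.\<close>

lemma quasihyp_dist_image_le:
  fixes h :: "real ^ 'n \<Rightarrow> real ^ 'n"
  assumes G: "proper_subdomain G" and G': "proper_subdomain (h ` G)"
    and h: "continuous_on G h" and "0 < A" "0 < C"
    and harnack: "\<And>p z. p \<in> G \<Longrightarrow> z \<in> cball p (bdist G p / 6) \<Longrightarrow>
      bdist (h ` G) (h p) \<le> A * bdist (h ` G) (h z)"
    and lip: "\<And>p x y. p \<in> G \<Longrightarrow> x \<in> cball p (bdist G p / 6) \<Longrightarrow> y \<in> cball p (bdist G p / 6) \<Longrightarrow>
      dist (h x) (h y) \<le> C * bdist (h ` G) (h p) / bdist G p * dist x y"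
    and xy: "x \<in> G" "y \<in> G"
  shows "quasihyp_dist (h ` G) (h x) (h y) \<le> 2 * A * C * quasihyp_dist G x y"
proof -
  let ?\<rho> = "\<lambda>z. 1 / bdist G z" and ?\<rho>' = "\<lambda>z. 1 / bdist (h ` G) z"
  have "quasihyp_dist (h ` G) (h x) (h y) / (2 * A * C) \<le> quasihyp_dist G x y"
  proof (rule quasihyp_dist_greatest[OF _ xy])
    show "is_domain G" using G by (simp add: proper_subdomain_def)
    fix \<gamma> assume \<gamma>: "rectifiable_joins G x y \<gamma>"
    define \<beta> where "\<beta> = h \<circ> \<gamma>"
    have rect: "rectifiable_path \<gamma>" and im: "path_image \<gamma> \<subseteq> G" and path: "path \<gamma>"
      using \<gamma> by (auto simp: rectifiable_joins_def rectifiable_path_def)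
    have inG: "\<gamma> t \<in> G" if "t \<in> {0..1}" for t
      using im that by (auto simp: path_image_def)
    have im': "path_image \<beta> \<subseteq> h ` G"
      using im by (auto simp: \<beta>_def path_image_compose)
    have path': "path \<beta>"
      unfolding \<beta>_def by (intro path_continuous_image path continuous_on_subset[OF h im])
    have cont: "continuous_on {0..1} (\<lambda>t. ?\<rho> (\<gamma> t))"
      by (rule continuous_on_path_inverse_bdist[OF G path im])
    have cont': "continuous_on {0..1} (\<lambda>t. ?\<rho>' (\<beta> t))"
      by (rule continuous_on_path_inverse_bdist[OF G' path' im'])
    have "continuous_on {0..1} (\<lambda>t. bdist G (\<gamma> t))"
      using path unfolding bdist_def path_def by (intro continuous_intros)
    \<comment> \<open>The least boundary distance along the compact curve yields one
      \<open>\<delta>\<close> that works for every starting parameter.\<close>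
    then obtain t0 where t0: "t0 \<in> {0..1}" "\<And>t. t \<in> {0..1} \<Longrightarrow> bdist G (\<gamma> t0) \<le> bdist G (\<gamma> t)"
      using continuous_attains_inf[of "{0..1::real}"] by (metis atLeastAtMost_iff compact_Icc empty_iff zero_le_one order_refl)
    have "0 < bdist G (\<gamma> t0) / 6"
      using bdist_pos[OF G inG[OF t0(1)]] by simp
    then obtain \<delta> where \<delta>: "0 < \<delta>"
      "\<And>s t. s \<in> {0..1} \<Longrightarrow> t \<in> {0..1} \<Longrightarrow> \<bar>s - t\<bar> \<le> \<delta> \<Longrightarrow> dist (\<gamma> s) (\<gamma> t) < bdist G (\<gamma> t0) / 6"
      using path_uniform[OF path] by blast
    have near: "\<gamma> r \<in> cball (\<gamma> s) (bdist G (\<gamma> s) / 6)"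
      if "0 \<le> s" "s \<le> r" "r \<le> t" "t \<le> 1" "t - s \<le> \<delta>" for r s t
      using \<delta>(2)[of s r] t0(2)[of s] that by simp
    define K where "K s = C * bdist (h ` G) (h (\<gamma> s)) / bdist G (\<gamma> s)" for s
    have len: "curve_length \<beta> s t \<le> ennreal (K s * (arc_length_fun \<gamma> t - arc_length_fun \<gamma> s))"
      if st: "0 \<le> s" "s \<le> t" "t \<le> 1" "t - s \<le> \<delta>" for s t
      unfolding right_diff_distrib
    proof (rule curve_length_le_increment)
      have sG: "\<gamma> s \<in> G" using inG st by simp
      fix a b assume ab: "s \<le> a" "a \<le> b" "b \<le> t"
      have "dist (\<beta> a) (\<beta> b) \<le> K s * dist (\<gamma> a) (\<gamma> b)"
        using lip[OF sG near[OF st(1) ab(1) _ st(3,4)] near[OF st(1) _ ab(3) st(3,4)]] ab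
        by (simp add: K_def \<beta>_def)
      also have "\<dots> \<le> K s * (arc_length_fun \<gamma> b - arc_length_fun \<gamma> a)"
        using dist_le_arc_length_fun_diff[OF rect, of a b] ab st \<open>0 < C\<close>
          bdist_pos[OF G sG] bdist_pos[OF G', of "h (\<gamma> s)"] sG
        by (intro mult_left_mono) (auto simp: K_def)
      finally show "dist (\<beta> a) (\<beta> b) \<le> K s * arc_length_fun \<gamma> b - K s * arc_length_fun \<gamma> a"
        by (simp add: right_diff_distrib)
    qed
    \<comment> \<open>Rectifiability of \<open>\<beta>\<close> comes before any use of its arc
      length measure; finiteness on the short subarcs suffices by additivity.\<close>
    have "curve_length \<beta> 0 1 < \<infinity>"
    proof (rule unit_interval_chain[OF \<delta>(1)])
      show "curve_length \<beta> s t < \<infinity>" if "0 \<le> s" "s \<le> t" "t \<le> 1" "t - s \<le> \<delta>" for s t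
        using le_less_trans[OF len[OF that]] by simp
      show "curve_length \<beta> r t < \<infinity>"
        if "r \<le> s" "s \<le> t" "curve_length \<beta> r s < \<infinity>" "curve_length \<beta> s t < \<infinity>" for r s t
        using that curve_length_add[of r s t \<beta>] by simp
    qed
    then have rect': "rectifiable_path \<beta>"
      using path' by (simp add: rectifiable_path_def)
    have "arc_integral_on \<beta> ?\<rho>' 0 1 \<le> 2 * A * C * arc_integral_on \<gamma> ?\<rho> 0 1"
    proof (rule unit_interval_chain[OF \<delta>(1),
          where P = "\<lambda>s t. arc_integral_on \<beta> ?\<rho>' s t \<le> 2 * A * C * arc_integral_on \<gamma> ?\<rho> s t"])
      fix s t :: real assume st: "0 \<le> s" "s \<le> t" "t \<le> 1" "t - s \<le> \<delta>"
      define p where "p = \<gamma> s"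
      define \<Delta> where "\<Delta> = arc_length_fun \<gamma> t - arc_length_fun \<gamma> s"
      have p: "p \<in> G" using inG st by (simp add: p_def)
      have pos: "bdist G p > 0" "bdist (h ` G) (h p) > 0"
        using bdist_pos[OF G p] bdist_pos[OF G', of "h p"] p by auto
      have K: "K s = C * bdist (h ` G) (h p) / bdist G p" "K s > 0"
        using pos \<open>0 < C\<close> by (auto simp: K_def p_def)
      have \<Delta>: "\<Delta> \<ge> 0" using arc_length_fun_diff(2)[OF rect st(1-3)] by (simp add: \<Delta>_def)
      have "ennreal (arc_length_fun \<beta> t - arc_length_fun \<beta> s) \<le> ennreal (K s * \<Delta>)"
        using len[OF st] by (simp add: arc_length_fun_diff(1)[OF rect' st(1-3)] \<Delta>_def)
      then have \<Delta>': "arc_length_fun \<beta> t - arc_length_fun \<beta> s \<le> K s * \<Delta>"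
        using ennreal_le_iff mult_nonneg_nonneg[OF less_imp_le[OF K(2)] \<Delta>] by blast
      have "arc_integral_on \<beta> ?\<rho>' s t
          \<le> A / bdist (h ` G) (h p) * (arc_length_fun \<beta> t - arc_length_fun \<beta> s)"
      proof (rule arc_integral_on_le[OF rect' cont' st(1-3)])
        fix r assume r: "s \<le> r" "r \<le> t"
        have "bdist (h ` G) (h p) \<le> A * bdist (h ` G) (\<beta> r)"
          using harnack[OF p] near[OF st(1) r st(3,4)] by (simp add: p_def \<beta>_def)
        moreover have "bdist (h ` G) (\<beta> r) > 0"
          using r st by (intro bdist_pos[OF G']) (auto simp: \<beta>_def inG)
        ultimately show "1 / bdist (h ` G) (\<beta> r) \<le> A / bdist (h ` G) (h p)"
          using pos by (simp add: field_simps)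
      qed
      also have "\<dots> \<le> A / bdist (h ` G) (h p) * (K s * \<Delta>)"
        using \<Delta>' pos \<open>0 < A\<close> by (intro mult_left_mono) auto
      also have "\<dots> = A * C * (1 / bdist G p * \<Delta>)"
        using pos by (simp add: K)
      also have "\<dots> \<le> A * C * (2 * arc_integral_on \<gamma> ?\<rho> s t)"
      proof (rule mult_left_mono)
        have "1 / (2 * bdist G p) * \<Delta> \<le> arc_integral_on \<gamma> ?\<rho> s t"
          unfolding \<Delta>_def
        proof (rule arc_integral_on_ge[OF rect cont st(1-3)])
          fix r assume r: "s \<le> r" "r \<le> t"
          \<comment> \<open>Within distance \<open>bdist G p / 6\<close> of \<open>p\<close> the
            boundary distance grows at most by the factor \<open>7/6\<close>; the cruder
            \<open>2\<close> gives the factor in \<open>2 * A * C\<close>.\<close>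
          have "bdist G (\<gamma> r) \<le> 2 * bdist G p"
            using bdist_le_add[of G "\<gamma> r" p] near[OF st(1) r st(3,4)] pos
            by (simp add: p_def dist_commute)
          moreover have "bdist G (\<gamma> r) > 0"
            using r st by (intro bdist_pos[OF G] inG) auto
          ultimately show "1 / (2 * bdist G p) \<le> ?\<rho> (\<gamma> r)"
            by (intro divide_left_mono) auto
        qed
        then show "1 / bdist G p * \<Delta> \<le> 2 * arc_integral_on \<gamma> ?\<rho> s t" by simp
      qed (use \<open>0 < A\<close> \<open>0 < C\<close> in simp)
      finally show "arc_integral_on \<beta> ?\<rho>' s t \<le> 2 * A * C * arc_integral_on \<gamma> ?\<rho> s t"
        by (simp add: mult_ac)
    next
      fix r s t :: real assume "0 \<le> r" "r \<le> s" "s \<le> t" "t \<le> 1"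
        "arc_integral_on \<beta> ?\<rho>' r s \<le> 2 * A * C * arc_integral_on \<gamma> ?\<rho> r s"
        "arc_integral_on \<beta> ?\<rho>' s t \<le> 2 * A * C * arc_integral_on \<gamma> ?\<rho> s t"
      then show "arc_integral_on \<beta> ?\<rho>' r t \<le> 2 * A * C * arc_integral_on \<gamma> ?\<rho> r t"
        using arc_integral_on_add[OF rect cont, of r s t] arc_integral_on_add[OF rect' cont', of r s t]
        by (simp add: distrib_left)
    qed
    moreover have "quasihyp_dist (h ` G) (h x) (h y) \<le> arc_integral_on \<beta> ?\<rho>' 0 1"
      unfolding arc_length_integral_eq[OF rect' cont', symmetric] using \<gamma> rect' im'
      by (intro quasihyp_dist_le) (auto simp: rectifiable_joins_def \<beta>_def pathstart_compose pathfinish_compose)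
    ultimately have "quasihyp_dist (h ` G) (h x) (h y) \<le> 2 * A * C * arc_length_integral \<gamma> ?\<rho>"
      by (simp add: arc_length_integral_eq[OF rect cont])
    then show "quasihyp_dist (h ` G) (h x) (h y) / (2 * A * C) \<le> arc_length_integral \<gamma> ?\<rho>"
      using \<open>0 < A\<close> \<open>0 < C\<close> by (simp add: divide_le_eq mult.commute)
  qed
  then show ?thesis
    using \<open>0 < A\<close> \<open>0 < C\<close> by (simp add: divide_le_eq mult.commute)
qed

section \<open>The two implications\<close>

lemma r_dist_le_iff:
  assumes "proper_subdomain D" "x \<in> D" "y \<in> D"
  shows "r_dist D x y \<le> c \<longleftrightarrow> dist x y \<le> c * min (bdist D x) (bdist D y)"
  using bdist_pos[OF assms(1,2)] bdist_pos[OF assms(1,3)]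
  by (simp add: r_dist_def dist_norm divide_le_eq)

lemma harmonic_mapping_continuous_on:
  assumes "harmonic_mapping_on S h"
  shows "continuous_on S h"
proof -
  have "continuous_on S (\<lambda>x. h x $ i)" for i
    using assms unfolding harmonic_mapping_on_def harmonic_on_def C2_on_def
    by (blast intro: differentiable_imp_continuous_on)
  then have "continuous_on S (\<lambda>x. \<chi> i. h x $ i)"
    by (intro continuous_on_vec_lambda)
  then show ?thesis by simp
qed

lemma weak_uniform_boundedness_imp_lipschitz:
  fixes G :: "(real ^ 'n) set"
  assumes G: "proper_subdomain G" and harm: "harmonic_mapping_on G h"
    and G': "proper_subdomain (h ` G)" and wub: "weak_uniform_boundedness G h"
  shows "quasihyp_lipschitz G h"
proof -
  obtain c where c: "c > 0"
    "\<And>x y. x \<in> G \<Longrightarrow> y \<in> G \<Longrightarrow> r_dist G x y \<le> 1/2 \<Longrightarrow> r_dist (h ` G) (h x) (h y) \<le> c"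
    using wub unfolding weak_uniform_boundedness_def by blast
  have sub: "cball p (bdist G p / 3) \<subseteq> G" if p: "p \<in> G" for p
    using ball_bdist_subset[OF G p] bdist_pos[OF G p] by fastforce
  \<comment> \<open>For \<open>z\<close> in this ball \<open>bdist G z\<close> is at least
    \<open>2/3\<close> of \<open>bdist G p\<close>, so the radius \<open>1/3\<close> is exactly half
    of that and \<open>r_dist G p z \<le> 1/2\<close>. The minimum is kept because its
    \<open>h z\<close> entry gives the comparison of boundary distances and its \<open>h p\<close>
    entry the oscillation bound.\<close>
  have osc: "dist (h p) (h z) \<le> c * min (bdist (h ` G) (h p)) (bdist (h ` G) (h z))"
    if p: "p \<in> G" and z: "z \<in> cball p (bdist G p / 3)" for p z
  proof -
    have zG: "z \<in> G" using sub[OF p] z by blast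
    have "bdist G z \<ge> 2 / 3 * bdist G p"
      using bdist_le_add[of G p z] z by simp
    then have "r_dist G p z \<le> 1/2"
      unfolding r_dist_le_iff[OF G p zG] using z bdist_pos[OF G p] by (simp add: min_def)
    then show ?thesis
      using c(2)[OF p zG] r_dist_le_iff[OF G', of "h p" "h z"] p zG by simp
  qed
  \<comment> \<open>The gradient estimate needs a ball of twice the radius, so \<open>1/3\<close>
    drops to \<open>1/6\<close>, whence the \<open>6\<close>. The companion constant
    \<open>1 + c\<close> comes from the triangle inequality for the boundary distance.\<close>
  define C where "C = 6 * real CARD('n) ^ 3 * (real CARD('n) + 1) * c"
  have C: "C > 0" using c by (simp add: C_def)
  have "quasihyp_dist (h ` G) (h x) (h y) \<le> 2 * (1 + c) * C * quasihyp_dist G x y"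
    if xy: "x \<in> G" "y \<in> G" for x y
  proof (rule quasihyp_dist_image_le[OF G G' harmonic_mapping_continuous_on[OF harm] _ C _ _ xy])
    fix p z assume p: "p \<in> G" and z: "z \<in> cball p (bdist G p / 6)"
    have "z \<in> cball p (bdist G p / 3)" using z bdist_pos[OF G p] by simp
    then have "dist (h p) (h z) \<le> c * bdist (h ` G) (h z)"
      using c(1) by (intro order_trans[OF osc[OF p] mult_left_mono]) auto
    then show "bdist (h ` G) (h p) \<le> (1 + c) * bdist (h ` G) (h z)"
      using bdist_le_add[of "h ` G" "h p" "h z"] by (simp add: distrib_right)
  next
    fix p x y assume p: "p \<in> G" and xy: "x \<in> cball p (bdist G p / 6)" "y \<in> cball p (bdist G p / 6)"
    have pos: "bdist G p > 0" "bdist (h ` G) (h p) > 0"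
      using bdist_pos[OF G p] bdist_pos[OF G', of "h p"] p by auto
    have "open G" using G by (simp add: proper_subdomain_def is_domain_def)
    have "norm (h x - h y) \<le> real CARD('n) ^ 3 * (real CARD('n) + 1) * (c * bdist (h ` G) (h p))
        / (bdist G p / 6) * norm (x - y)"
    proof (rule harmonic_mapping_lipschitz[OF \<open>open G\<close> harm _ _ _ _ xy])
      show "cball p (2 * (bdist G p / 6)) \<subseteq> G" using sub[OF p] by simp
      fix w assume "w \<in> cball p (2 * (bdist G p / 6))"
      then have "dist (h p) (h w) \<le> c * bdist (h ` G) (h p)"
        using c(1) by (intro order_trans[OF osc[OF p] mult_left_mono]) auto
      then show "norm (h w - h p) \<le> c * bdist (h ` G) (h p)"
        by (simp add: dist_norm norm_minus_commute)
    qed (use pos c in auto)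
    then show "dist (h x) (h y) \<le> C * bdist (h ` G) (h p) / bdist G p * dist x y"
      by (simp add: C_def dist_norm mult_ac)
  qed (use c in auto)
  moreover have "2 * (1 + c) * C > 0" using c C by simp
  ultimately show ?thesis
    unfolding quasihyp_lipschitz_def by blast
qed

lemma lipschitz_imp_weak_uniform_boundedness:
  fixes G :: "(real ^ 'n) set"
  assumes G: "proper_subdomain G" and G': "proper_subdomain (h ` G)"
    and lip: "quasihyp_lipschitz G h"
  shows "weak_uniform_boundedness G h"
proof -
  obtain L where L: "L > 0"
    "\<And>x y. x \<in> G \<Longrightarrow> y \<in> G \<Longrightarrow> quasihyp_dist (h ` G) (h x) (h y) \<le> L * quasihyp_dist G x y"
    using lip unfolding quasihyp_lipschitz_def by blast
  \<comment> \<open>The \<open>2\<close> in \<open>exp (2 * L)\<close> is that of the logarithmic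
    lower bound. Only the boundary distance of the first image point occurs here; applying the
    estimate in both orders reaches the minimum in \<open>r_dist\<close>.\<close>
  have one_sided: "dist (h x) (h y) \<le> exp (2 * L) * bdist (h ` G) (h x)"
    if x: "x \<in> G" and y: "y \<in> G" and xy: "dist x y \<le> bdist G x / 2" for x y
  proof -
    have d: "bdist G x > 0" and d': "bdist (h ` G) (h x) > 0"
      using bdist_pos[OF G x] bdist_pos[OF G', of "h x"] x by auto
    have "quasihyp_dist G x y \<le> dist x y / (bdist G x - dist x y)"
      using xy d by (intro quasihyp_dist_le_segment[OF G x]) simp
    also have "\<dots> \<le> 1" using xy d by (simp add: divide_le_eq)
    finally have "L * quasihyp_dist G x y \<le> L * 1"
      using L(1) by (intro mult_left_mono) auto
    moreover have "ln (1 + dist (h x) (h y) / bdist (h ` G) (h x)) / 2 \<le> quasihyp_dist (h ` G) (h x) (h y)"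
      using x y by (intro quasihyp_dist_ge_ln[OF G']) auto
    ultimately have "ln (1 + dist (h x) (h y) / bdist (h ` G) (h x)) \<le> 2 * L"
      using L(2)[OF x y] by linarith
    moreover have "1 + dist (h x) (h y) / bdist (h ` G) (h x) > 0"
      using d' by (intro add_pos_nonneg) auto
    ultimately have "1 + dist (h x) (h y) / bdist (h ` G) (h x) \<le> exp (2 * L)"
      by (metis exp_le_cancel_iff exp_ln)
    then have "dist (h x) (h y) / bdist (h ` G) (h x) \<le> exp (2 * L)" by linarith
    then show ?thesis using d' by (simp add: divide_le_eq)
  qed
  have "r_dist (h ` G) (h x) (h y) \<le> exp (2 * L)"
    if x: "x \<in> G" and y: "y \<in> G" and "r_dist G x y \<le> 1/2" for x y
  proof -
    have "dist x y \<le> bdist G x / 2" "dist y x \<le> bdist G y / 2"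
      using that r_dist_le_iff[OF G x y, of "1/2"] by (auto simp: dist_commute)
    then show ?thesis
      using one_sided[OF x y] one_sided[OF y x] r_dist_le_iff[OF G', of "h x" "h y"] x y
      by (simp add: dist_commute min_def)
  qed
  then show ?thesis
    unfolding weak_uniform_boundedness_def using exp_gt_zero by blast
qed

theorem theorem2p19:
  fixes G :: "(real ^ 'n) set" and h :: "real ^ 'n \<Rightarrow> real ^ 'n"
  assumes "CARD('n) \<ge> 2"
    and "proper_subdomain G"
    and "harmonic_mapping_on G h"
    and "proper_subdomain (h ` G)"
  shows "weak_uniform_boundedness G h \<longleftrightarrow> quasihyp_lipschitz G h"
  using weak_uniform_boundedness_imp_lipschitz[OF assms(2-4)]
    lipschitz_imp_weak_uniform_boundedness[OF assms(2,4)] by (rule iffI)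

end
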